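(* Let $H$ be an infinite-dimensional Hilbert space and let $\mathcal{B}=\mathcal{K}(H)+\mathbb{C}\mathbf{1}\subset\mathcal{B}(H)$ be the unitization of the compact operators on $H$, where $\mathcal{B}(H)$ denotes the algebra of all bounded operators on $H$. Let $h\in\mathcal{B}(H)\setminus\mathcal{B}$ be self-adjoint and consider the automorphism semigroup $\vartheta_t(b)=e^{ith}be^{-ith}$ $(b\in\mathcal{B},\ t\in\mathbb{R}_+)$ on $\mathcal{B}$. Then $\vartheta=(\vartheta_t)_{t\in\mathbb{R}_+}$ is a uniformly continuous Markov semigroup on $\mathcal{B}$ that is not spatial. Equivalently, its GNS-system, though type I, does not embed into a time ordered product system $\Gamma^\odot(F)$ for any correspondence $F$ over $\mathcal{B}$.
   Context: CP-semigroups. A CP-semigroup on a unital $C^*$-algebra $\mathcal{B}$ is a one-parameter semigroup $T=(T_t)_{t\in\mathbb{R}_+}$ ($\mathbb{R}_+=[0,\infty)$, $T_0=\mathrm{id}$) of completely positive maps on $\mathcal{B}$; it is a Markov semigroup if $T_t(\mathbf{1})=\mathbf{1}$ for all $t$, strongly continuous if $t\mapsto T_t(b)$ is norm continuous for every $b$, and uniformly continuous if $t\mapsto T_t$ is operator norm continuous. A strongly continuous CP-semigroup $T$ is spatial if there is a norm continuous semigroup $c=(c_t)_{t\in\mathbb{R}_+}$ of elements of $\mathcal{B}$ ($c_sc_t=c_{s+t}$, $c_0=\mathbf{1}$) such that for every $t$ the map $b\mapsto T_t(b)-c_t^*bc_t$ on $\mathcal{B}$ is completely positive. Product systems. A correspondence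 over $\mathcal{B}$ is a right Hilbert $\mathcal{B}$-module with a nondegenerate (unital) left action of $\mathcal{B}$ by adjointable operators; $\odot$ is the internal tensor product over $\mathcal{B}$; "bilinear" means $\mathcal{B}$-$\mathcal{B}$-bimodule map. A product system is a family $E^\odot=(E_t)_{t\in\mathbb{R}_+}$ of correspondences over $\mathcal{B}$ with bilinear unitaries $u_{s,t}\colon E_s\odot E_t\to E_{s+t}$ such that the product $x_sy_t:=u_{s,t}(x_s\odot y_t)$ is associative, with $E_0=\mathcal{B}$ and $u_{0,t},u_{s,0}$ being left and right multiplication by elements of $\mathcal{B}$. An embedding of $E^\odot$ into a product system $G^\odot$ is a family of bilinear inner-product-preserving maps $v_t\colon E_t\to G_t$ with $v_0=\mathrm{id}_{\mathcal{B}}$ and $v_{s+t}(x_sy_t)=v_s(x_s)v_t(y_t)$. A unit is a family $\xi^\odot=(\xi_t)$, $\xi_t\in E_t$, with $\xi_s\xi_t=\xi_{s+t}$, $\xi_0=\mathbf{1}$. A set $S$ of units is continuous if for all $\xi^\odot,\xi'^\odot\in S$ the semigroup $t\mapsto\langle\xi_t,\bullet\,\xi'_t\rangle$ of maps on $\mathcal{B}$ is uniformly continuous. $E^\odot$ is generated by $S$ if for $t>0$, $E_t$ is the closed linear span of all $b_n\xi^{(n)}_{t_n}\cdots b_1\xi^{(1)}_{t_1}b_0$ with $n\in\mathbb{N}$, $t_i>0$, $\sum t_i=t$, $b_i\in\mathcal{B}$, $\xi^{(i)\odot}\in S$. $E^\odot$ is type I if it is generated by a continuous set of units. GNS-system.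 For every CP-semigroup $T$ on $\mathcal{B}$ there is a pair $(E^\odot,\xi^\odot)$, unique up to isomorphism, of a product system and a unit such that $T_t(b)=\langle\xi_t,b\xi_t\rangle$ for all $b,t$ and $E^\odot$ is generated by $\{\xi^\odot\}$; $E^\odot$ is the GNS-system of $T$. For $T=\vartheta$ a semigroup of unital endomorphisms of $\mathcal{B}$, it is $E_t=\mathcal{B}$ as right Hilbert module with left action $b.x=\vartheta_t(b)x$, product $x_s\odot y_t\mapsto\vartheta_t(x_s)y_t$, and unit $\xi_t=\mathbf{1}$. Time ordered product systems. For a correspondence $F$ over $\mathcal{B}$, $L^2(\mathbb{R}_+,F)$ is the completion of the right continuous (compactly supported) $F$-valued step functions with respect to $\langle f,g\rangle=\int\langle f(s),g(s)\rangle\,ds$, with pointwise actions. The full Fock module is $\mathcal{F}(L^2(\mathbb{R}_+,F))=\bigoplus_{n\ge0}L^2(\mathbb{R}_+,F)^{\odot n}$ with $L^2(\mathbb{R}_+,F)^{\odot0}=\mathcal{B}$; the $n$-particle sector $L^2(\mathbb{R}_+,F)^{\odot n}$ is viewed as the completion of the $F^{\odot n}$-valued step functions on $\mathbb{R}_+^n$. Let $\Delta_n$ be multiplication by the indicator function of $\{(t_n,\dots,t_1):t_n>\dots>t_1\ge0\}$ ($\Delta_0=\mathrm{id}$) and $\Delta=\bigoplus_n\Delta_n$. Then $\Gamma(F)=\Delta\mathcal{F}(L^2(\mathbb{R}_+,F))$, and $\Gamma_t(F)$ is its subcorrespondence of functions vanishing whenever the largest time argument satisfies $t_n\ge t$ (so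 $\Gamma_0(F)=\mathcal{B}$). With $[u_{s,t}(F_s^m\odot G_t^n)](s_m,\dots,s_1,t_n,\dots,t_1)=F_s^m(s_m-t,\dots,s_1-t)\odot G_t^n(t_n,\dots,t_1)$, the family $\Gamma^\odot(F)=(\Gamma_t(F))_{t\in\mathbb{R}_+}$ is a product system, the time ordered product system over $F$. *)

theory Defs
  imports "HOL-Analysis.Analysis" "HOL-Library.Function_Algebras"
begin

section \<open>Complex Hilbert spaces and unital \<open>C\<^sup>*\<close>-algebras\<close>

class scaleC =
  fixes scaleC :: "complex \<Rightarrow> 'a \<Rightarrow> 'a" (infixr \<open>*\<^sub>C\<close> 75)

class complex_normed_vector = real_normed_vector + scaleC +
  assumes scaleC_add_right: "a *\<^sub>C (x + y) = a *\<^sub>C x + a *\<^sub>C y"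
    and scaleC_add_left: "(a + b) *\<^sub>C x = a *\<^sub>C x + b *\<^sub>C x"
    and scaleC_scaleC: "a *\<^sub>C (b *\<^sub>C x) = (a * b) *\<^sub>C x"
    and scaleC_of_real: "complex_of_real r *\<^sub>C x = r *\<^sub>R x"
    and norm_scaleC: "norm (a *\<^sub>C x) = cmod a * norm x"

text \<open>The inner product is conjugate linear in its first argument; the norm is the one of
  \<^class>\<open>real_inner\<close>, so that \<open>cinner x x\<close> is the square of the norm of \<open>x\<close>.\<close>

class chilbert_space = complex_normed_vector + real_inner + banach +
  fixes cinner :: "'a \<Rightarrow> 'a \<Rightarrow> complex"
  assumes cinner_add_right: "cinner x (y + z) = cinner x y + cinner x z"
    and cinner_scaleC_right: "cinner x (a *\<^sub>C y) = a * cinner x y"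
    and cinner_commute: "cinner x y = cnj (cinner y x)"
    and Re_cinner: "Re (cinner x y) = inner x y"

class unital_cstar = complex_normed_vector + real_normed_algebra_1 + banach +
  fixes star :: "'a \<Rightarrow> 'a"
  assumes mult_scaleC_left: "(a *\<^sub>C x) * y = a *\<^sub>C (x * y)"
    and mult_scaleC_right: "x * (a *\<^sub>C y) = a *\<^sub>C (x * y)"
    and star_star: "star (star x) = x"
    and star_add: "star (x + y) = star x + star y"
    and star_scaleC: "star (a *\<^sub>C x) = cnj a *\<^sub>C star x"
    and star_mult: "star (x * y) = star y * star x"
    and cstar_identity: "norm (star x * x) = (norm x)\<^sup>2"

lemma scaleC_zero_right [simp]: "a *\<^sub>C (0::'a::complex_normed_vector) = 0"
  using scaleC_add_right[of a "0::'a" 0] by simp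

lemma scaleC_one [simp]: "1 *\<^sub>C (x::'a::complex_normed_vector) = x"
  using scaleC_of_real[of 1 x] by simp

lemma scaleC_zero_left [simp]: "0 *\<^sub>C (x::'a::complex_normed_vector) = 0"
  using scaleC_of_real[of 0 x] by simp

lemma scaleC_minus1: "(- 1) *\<^sub>C (x::'a::complex_normed_vector) = - x"
  using scaleC_of_real[of "-1" x] by simp

lemma scaleC_minus_right: "a *\<^sub>C (- (x::'a::complex_normed_vector)) = - (a *\<^sub>C x)"
  using scaleC_add_right[of a x "-x"] by (simp add: eq_neg_iff_add_eq_0 add.commute)

lemma scaleC_diff_right: "a *\<^sub>C ((x::'a::complex_normed_vector) - y) = a *\<^sub>C x - a *\<^sub>C y"
  using scaleC_add_right[of a x "-y"] by (simp add: scaleC_minus_right)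

lemma scaleC_diff_left: "(a - b) *\<^sub>C (x::'a::complex_normed_vector) = a *\<^sub>C x - b *\<^sub>C x"
  using scaleC_add_left[of "a - b" b x] by (simp add: eq_diff_eq)

lemma scaleC_scaleR: "a *\<^sub>C (r *\<^sub>R x) = r *\<^sub>R (a *\<^sub>C (x::'a::complex_normed_vector))"
  by (simp flip: scaleC_of_real add: scaleC_scaleC mult.commute)

lemma bounded_linear_scaleC: "bounded_linear (\<lambda>x::'a::complex_normed_vector. a *\<^sub>C x)"
  by (rule bounded_linear_intro[where K="cmod a"])
     (auto simp: scaleC_add_right scaleC_scaleR norm_scaleC)

lemma tendsto_scaleC_right:
  "(f \<longlongrightarrow> l) F \<Longrightarrow> ((\<lambda>x. a *\<^sub>C (f x :: 'a::complex_normed_vector)) \<longlongrightarrow> a *\<^sub>C l) F"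
  by (rule bounded_linear.tendsto[OF bounded_linear_scaleC])

lemma bounded_linear_scaleC_left:
  "bounded_linear (\<lambda>a. a *\<^sub>C (x::'a::complex_normed_vector))"
proof (rule bounded_linear_intro[where K="norm x"])
  show "(r *\<^sub>R a) *\<^sub>C x = r *\<^sub>R (a *\<^sub>C x)" for r a
    by (simp add: scaleR_conv_of_real flip: scaleC_scaleC scaleC_of_real)
qed (auto simp: scaleC_add_left norm_scaleC)

lemma cinner_add_left: "cinner ((x::'a::chilbert_space) + y) z = cinner x z + cinner y z"
  by (metis cinner_add_right cinner_commute complex_cnj_add)

lemma cinner_scaleC_left: "cinner (a *\<^sub>C (x::'a::chilbert_space)) y = cnj a * cinner x y"
  by (metis cinner_scaleC_right cinner_commute complex_cnj_mult)

lemma cinner_self: "cinner (x::'a::chilbert_space) x = complex_of_real ((norm x)\<^sup>2)"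
proof (rule complex_eqI)
  show "Re (cinner x x) = Re (complex_of_real ((norm x)\<^sup>2))"
    by (simp add: Re_cinner norm_eq_sqrt_inner)
  have "Im (cinner x x) = - Im (cinner x x)"
    by (metis cinner_commute cnj.sel(2))
  then show "Im (cinner x x) = Im (complex_of_real ((norm x)\<^sup>2))" by simp
qed

lemma Im_cinner: "Im (cinner (x::'a::chilbert_space) y) = - inner x (\<i> *\<^sub>C y)"
  by (simp flip: Re_cinner add: cinner_scaleC_right)

lemma cinner_diff_right: "cinner (x::'a::chilbert_space) (y - z) = cinner x y - cinner x z"
  using cinner_add_right[of x "y - z" z] by (simp add: eq_diff_eq)

lemma cinner_diff_left: "cinner ((x::'a::chilbert_space) - y) z = cinner x z - cinner y z"
  using cinner_add_left[of "x - y" y z] by (simp add: eq_diff_eq)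

lemma cinner_eqI: "(\<And>z. cinner (x::'a::chilbert_space) z = cinner y z) \<Longrightarrow> x = y"
  using cinner_diff_left[of x y "x - y"] cinner_self[of "x - y"] by simp

lemma norm_cinner_le: "cmod (cinner x y) \<le> norm x * norm (y::'a::chilbert_space)"
proof (cases "cinner x y = 0")
  case False
  define u where "u = cnj (cinner x y) / complex_of_real (cmod (cinner x y))"
  have u: "cmod u = 1" using False by (simp add: u_def norm_divide)
  have "u * cinner x y = complex_of_real (cmod (cinner x y))"
    using False complex_norm_square[of "cinner x y"]
    by (simp add: u_def mult.commute power2_eq_square divide_eq_eq)
  then have "cmod (cinner x y) = Re (cinner x (u *\<^sub>C y))"
    by (simp add: cinner_scaleC_right)
  also have "\<dots> \<le> norm x * norm (u *\<^sub>C y)"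
    unfolding Re_cinner by (rule norm_cauchy_schwarz)
  finally show ?thesis by (simp add: norm_scaleC u)
qed simp

section \<open>The \<open>C\<^sup>*\<close>-algebra of bounded operators\<close>

lemma real_riesz:
  fixes f :: "'a::{real_inner,banach} \<Rightarrow> real"
  assumes "bounded_linear f"
  obtains y where "\<And>x. f x = inner y x"
proof -
  interpret f: bounded_linear f by fact
  define Q where "Q x = (norm x)\<^sup>2 - 2 * f x" for x
  obtain K where K: "\<And>x. norm (f x) \<le> norm x * K" using f.bounded by blast
  have lb: "Q x \<ge> - K\<^sup>2" for x
  proof -
    have "f x \<le> norm x * K" using K[of x] by simp
    moreover have "(norm x - K)\<^sup>2 \<ge> 0" by simp
    ultimately show ?thesis unfolding Q_def by (simp add: power2_diff algebra_simps)
  qed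
  define m where "m = Inf (range Q)"
  have bdd: "bdd_below (range Q)" using lb by (auto intro!: bdd_belowI[of _ "- K\<^sup>2"])
  have mle: "m \<le> Q x" for x unfolding m_def by (rule cInf_lower[OF _ bdd]) simp
  have "\<exists>x. Q x < m + 1 / real (Suc n)" for n
  proof -
    have "Inf (range Q) < m + 1 / real (Suc n)" by (simp add: m_def)
    from cInf_lessD[OF _ this] show ?thesis by auto
  qed
  then obtain s where s: "\<And>n. Q (s n) < m + 1 / real (Suc n)" by metis
  have par: "(norm (x - y))\<^sup>2 \<le> 2 * (Q x - m) + 2 * (Q y - m)" for x y
  proof -
    have "4 * m \<le> 4 * Q ((1/2) *\<^sub>R (x + y))" using mle by simp
    also have "\<dots> = (norm (x + y))\<^sup>2 - 4 * f x - 4 * f y"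
      by (simp add: Q_def f.scaleR f.add power2_eq_square) (simp add: field_simps)
    also have "\<dots> = 2 * (norm x)\<^sup>2 + 2 * (norm y)\<^sup>2 - (norm (x - y))\<^sup>2 - 4 * f x - 4 * f y"
      by (simp add: power2_norm_eq_inner inner_add inner_diff inner_commute algebra_simps)
    finally show ?thesis by (simp add: Q_def)
  qed
  have "Cauchy s"
  proof (rule metric_CauchyI)
    fix e :: real assume e: "e > 0"
    obtain N where N: "1 / real (Suc N) < e\<^sup>2 / 4"
      using e nat_approx_posE[of "e\<^sup>2 / 4"] by (metis divide_pos_pos zero_less_numeral zero_less_power)
    have "dist (s i) (s j) < e" if "i \<ge> N" "j \<ge> N" for i j
    proof -
      define a where "a k = 1 / real (Suc k)" for k
      have "a i \<le> a N" "a j \<le> a N"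
        using that by (auto simp: a_def intro!: divide_left_mono)
      moreover have "Q (s i) < m + a i" "Q (s j) < m + a j"
        using s by (simp_all only: a_def)
      moreover have "4 * a N < e\<^sup>2"
        using N by (simp add: a_def field_simps)
      ultimately have "(norm (s i - s j))\<^sup>2 < e\<^sup>2"
        using par[of "s i" "s j"] by argo
      then show ?thesis using e by (simp add: dist_norm power_less_imp_less_base)
    qed
    then show "\<exists>M. \<forall>m\<ge>M. \<forall>n\<ge>M. dist (s m) (s n) < e" by blast
  qed
  then obtain y where y: "s \<longlonglongrightarrow> y" by (meson Cauchy_convergent convergentD)
  have "(\<lambda>n. Q (s n)) \<longlonglongrightarrow> Q y"
    unfolding Q_def by (intro tendsto_intros f.tendsto y)
  moreover have "(\<lambda>n. m + 1 / real (Suc n)) \<longlonglongrightarrow> m"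
    using LIMSEQ_inverse_real_of_nat by (auto simp: inverse_eq_divide intro: tendsto_eq_intros)
  ultimately have Qy: "Q y \<le> m"
    using s by (intro LIMSEQ_le) (auto intro: less_imp_le)
  have "f x = inner y x" for x
  proof (rule ccontr)
    assume ne: "f x \<noteq> inner y x"
    define d where "d = inner y x - f x"
    have q: "Q (y + r *\<^sub>R x) = Q y + 2 * r * d + r\<^sup>2 * (norm x)\<^sup>2" for r
    proof -
      have "(norm (y + r *\<^sub>R x))\<^sup>2 = (norm y)\<^sup>2 + 2 * r * inner y x + r\<^sup>2 * (norm x)\<^sup>2"
        unfolding power2_norm_eq_inner
        by (simp add: inner_add inner_commute algebra_simps power2_eq_square)
      then show ?thesis by (simp add: Q_def d_def f.add f.scaleR algebra_simps)
    qed
    have x0: "norm x > 0" using ne by (auto simp: f.zero)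
    let ?r = "- d / (norm x)\<^sup>2"
    have "Q (y + ?r *\<^sub>R x) = Q y - d\<^sup>2 / (norm x)\<^sup>2"
      unfolding q using x0 by (simp add: power2_eq_square field_simps)
    moreover have "d\<^sup>2 / (norm x)\<^sup>2 > 0" using ne x0 by (simp add: d_def)
    ultimately show False using mle[of "y + ?r *\<^sub>R x"] Qy by linarith
  qed
  then show ?thesis using that by blast
qed

lemma Blinfun_scaleC_apply:
  fixes A :: "'a::complex_normed_vector \<Rightarrow>\<^sub>L 'a"
  shows "blinfun_apply (Blinfun (\<lambda>x. c *\<^sub>C blinfun_apply A x)) x = c *\<^sub>C blinfun_apply A x"
proof -
  have "bounded_linear (\<lambda>x. c *\<^sub>C blinfun_apply A x)"
    by (rule bounded_linear_compose[OF bounded_linear_scaleC blinfun.bounded_linear_right])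
  then show ?thesis by (simp add: bounded_linear_Blinfun_apply)
qed

typedef (overloaded) 'h bop =
  "{A :: 'h::chilbert_space \<Rightarrow>\<^sub>L 'h. \<forall>c x. A (c *\<^sub>C x) = c *\<^sub>C A x}"
  morphisms blinfun_of_bop Abs_bop
  by (rule exI[of _ 0]) simp

setup_lifting type_definition_bop

lift_definition bop_apply :: "'h::chilbert_space bop \<Rightarrow> 'h \<Rightarrow> 'h" is blinfun_apply .

lemma bop_apply_scaleC: "bop_apply A (c *\<^sub>C x) = c *\<^sub>C bop_apply A x"
  by transfer simp

lemma bop_eqI: "(\<And>x. bop_apply A x = bop_apply B x) \<Longrightarrow> A = B"
  by transfer (rule blinfun_eqI)

instantiation bop :: (chilbert_space) complex_normed_vector
begin

lift_definition zero_bop :: "'a bop" is 0 by simp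
lift_definition plus_bop :: "'a bop \<Rightarrow> 'a bop \<Rightarrow> 'a bop" is "(+)"
  by (simp add: blinfun.add_left scaleC_add_right)
lift_definition minus_bop :: "'a bop \<Rightarrow> 'a bop \<Rightarrow> 'a bop" is "(-)"
  by (simp add: blinfun.diff_left scaleC_diff_right)
lift_definition uminus_bop :: "'a bop \<Rightarrow> 'a bop" is uminus
  by (simp add: blinfun.minus_left scaleC_minus_right)
lift_definition scaleR_bop :: "real \<Rightarrow> 'a bop \<Rightarrow> 'a bop" is scaleR
  by (simp add: blinfun.scaleR_left scaleC_scaleR)
lift_definition scaleC_bop :: "complex \<Rightarrow> 'a bop \<Rightarrow> 'a bop" is
  "\<lambda>c A. Blinfun (\<lambda>x. c *\<^sub>C blinfun_apply A x)"
  by (simp add: Blinfun_scaleC_apply scaleC_scaleC mult.commute)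
lift_definition norm_bop :: "'a bop \<Rightarrow> real" is norm .
lift_definition dist_bop :: "'a bop \<Rightarrow> 'a bop \<Rightarrow> real" is dist .
definition sgn_bop :: "'a bop \<Rightarrow> 'a bop" where "sgn_bop A = scaleR (inverse (norm A)) A"
definition uniformity_bop :: "('a bop \<times> 'a bop) filter" where
  "uniformity_bop = (INF e\<in>{0<..}. principal {(x, y). dist x y < e})"
definition open_bop :: "'a bop set \<Rightarrow> bool" where
  "open_bop S = (\<forall>x\<in>S. \<forall>\<^sub>F (x', y) in uniformity. x' = x \<longrightarrow> y \<in> S)"

lemma scaleC_bop_apply: "bop_apply (c *\<^sub>C A) x = c *\<^sub>C bop_apply A x"
  by transfer (simp add: Blinfun_scaleC_apply)

lemma plus_bop_apply: "bop_apply (A + B) x = bop_apply A x + bop_apply B x"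
  by transfer (simp add: blinfun.add_left)

lemma scaleR_bop_apply: "bop_apply (r *\<^sub>R A) x = r *\<^sub>R bop_apply A x"
  by transfer (simp add: blinfun.scaleR_left)

instance
proof
  fix A B C :: "'a bop" and a b :: complex and r s :: real
  show "A + B + C = A + (B + C)" by transfer simp
  show "A + B = B + A" by transfer simp
  show "0 + A = A" by transfer simp
  show "- A + A = 0" by transfer simp
  show "A - B = A + - B" by transfer simp
  show "r *\<^sub>R (A + B) = r *\<^sub>R A + r *\<^sub>R B" by transfer (simp add: scaleR_add_right)
  show "(r + s) *\<^sub>R A = r *\<^sub>R A + s *\<^sub>R A" by transfer (simp add: scaleR_add_left)
  show "r *\<^sub>R s *\<^sub>R A = (r * s) *\<^sub>R A" by transfer simp
  show "1 *\<^sub>R A = A" by transfer simp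
  show "dist A B = norm (A - B)" by transfer (simp add: dist_norm)
  show "sgn A = inverse (norm A) *\<^sub>R A" by (simp add: sgn_bop_def)
  show "uniformity = (INF e\<in>{0<..}. principal {(x, y). dist (x::'a bop) y < e})"
    by (rule uniformity_bop_def)
  show "open S = (\<forall>x\<in>S. \<forall>\<^sub>F (x', y) in uniformity. x' = x \<longrightarrow> y \<in> S)" for S :: "'a bop set"
    by (rule open_bop_def)
  show "(norm A = 0) = (A = 0)" by transfer simp
  show "norm (A + B) \<le> norm A + norm B" by transfer (rule norm_triangle_ineq)
  show "norm (r *\<^sub>R A) = \<bar>r\<bar> * norm A" by transfer simp
  show "a *\<^sub>C (A + B) = a *\<^sub>C A + a *\<^sub>C B"
    by (rule bop_eqI) (simp add: scaleC_bop_apply plus_bop_apply scaleC_add_right)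
  show "(a + b) *\<^sub>C A = a *\<^sub>C A + b *\<^sub>C A"
    by (rule bop_eqI) (simp add: scaleC_bop_apply plus_bop_apply scaleC_add_left)
  show "a *\<^sub>C b *\<^sub>C A = (a * b) *\<^sub>C A"
    by (rule bop_eqI) (simp add: scaleC_bop_apply scaleC_scaleC)
  show "complex_of_real r *\<^sub>C A = r *\<^sub>R A"
    by (rule bop_eqI) (simp add: scaleC_bop_apply scaleC_of_real scaleR_bop_apply)
  show "norm (a *\<^sub>C A) = cmod a * norm A"
  proof transfer
    fix a :: complex and A :: "'a \<Rightarrow>\<^sub>L 'a"
    let ?B = "Blinfun (\<lambda>x. a *\<^sub>C blinfun_apply A x)"
    have ap: "blinfun_apply ?B x = a *\<^sub>C blinfun_apply A x" for x
      by (simp add: Blinfun_scaleC_apply)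
    have le: "norm ?B \<le> cmod a * norm A"
      by (rule norm_blinfun_bound)
         (auto simp: ap norm_scaleC mult.assoc intro!: mult_left_mono norm_blinfun)
    have ge: "cmod a * norm A \<le> norm ?B"
    proof (cases "a = 0")
      case False
      have "norm A \<le> norm ?B / cmod a"
      proof (rule norm_blinfun_bound)
        show "norm (blinfun_apply A x) \<le> norm ?B / cmod a * norm x" for x
          using norm_blinfun[of ?B x] False by (simp add: ap norm_scaleC field_simps)
      qed simp
      then show ?thesis using False by (simp add: field_simps)
    qed simp
    show "norm ?B = cmod a * norm A" using le ge by simp
  qed
qed

end

lemma zero_bop_apply [simp]: "bop_apply 0 x = 0"
  by transfer simp
lemma minus_bop_apply: "bop_apply (A - B) x = bop_apply A x - bop_apply B x"
  by transfer (simp add: blinfun.diff_left)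
lemma bounded_linear_bop_apply: "bounded_linear (bop_apply A)"
  by transfer (rule blinfun.bounded_linear_right)
lemma norm_bop_apply: "norm (bop_apply A x) \<le> norm A * norm x"
  by transfer (rule norm_blinfun)
lemma norm_bop_bound: "0 \<le> b \<Longrightarrow> (\<And>x. norm (bop_apply A x) \<le> b * norm x) \<Longrightarrow> norm A \<le> b"
  by transfer (rule norm_blinfun_bound)

instance bop :: (chilbert_space) banach
proof
  fix X :: "nat \<Rightarrow> 'a bop" assume "Cauchy X"
  then have "Cauchy (\<lambda>n. blinfun_of_bop (X n))"
    unfolding Cauchy_def dist_bop.rep_eq .
  then obtain L where L: "(\<lambda>n. blinfun_of_bop (X n)) \<longlonglongrightarrow> L"
    by (meson Cauchy_convergent convergentD)
  have p: "(\<lambda>n. bop_apply (X n) x) \<longlonglongrightarrow> L x" for x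
    unfolding bop_apply.rep_eq by (intro tendsto_intros L)
  have "L (c *\<^sub>C x) = c *\<^sub>C L x" for c x
    using p[of "c *\<^sub>C x"] tendsto_scaleC_right[OF p[of x], of c]
    by (simp add: bop_apply_scaleC LIMSEQ_unique)
  then have "blinfun_of_bop (Abs_bop L) = L" by (simp add: Abs_bop_inverse)
  then have "X \<longlonglongrightarrow> Abs_bop L"
    using L by (simp add: lim_sequentially dist_bop.rep_eq)
  then show "convergent X" by (auto simp: convergent_def)
qed

instantiation bop :: ("{chilbert_space,perfect_space}") real_normed_algebra_1
begin

lift_definition one_bop :: "'a bop" is id_blinfun by simp
lift_definition times_bop :: "'a bop \<Rightarrow> 'a bop \<Rightarrow> 'a bop" is blinfun_compose by simp

lemma times_bop_apply: "bop_apply (A * B) x = bop_apply A (bop_apply B x)"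
  by transfer simp
lemma one_bop_apply [simp]: "bop_apply 1 x = x"
  by transfer simp

instance
proof
  fix A B C :: "'a bop" and r :: real
  note [simp] = plus_bop_apply scaleR_bop_apply times_bop_apply
  interpret A: bounded_linear "bop_apply A" by (rule bounded_linear_bop_apply)
  show "A * B * C = A * (B * C)" "(A + B) * C = A * C + B * C" "A * (B + C) = A * B + A * C"
    "1 * A = A" "A * 1 = A" "r *\<^sub>R A * B = r *\<^sub>R (A * B)" "A * r *\<^sub>R B = r *\<^sub>R (A * B)"
    by (auto intro!: bop_eqI simp: A.add A.scaleR)
  show "norm (A * B) \<le> norm A * norm B"
    by transfer (rule norm_blinfun_compose)
  show n1: "norm (1 :: 'a bop) = 1" by transfer (rule norm_blinfun_id)
  show "(0::'a bop) \<noteq> 1" using n1 by (metis norm_zero zero_neq_one)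
qed

end

lemma adjoint_exists:
  fixes A :: "'h::chilbert_space bop"
  shows "\<exists>B. \<forall>x y. cinner (bop_apply B x) y = cinner x (bop_apply A y)"
proof -
  interpret A: bounded_linear "bop_apply A" by (rule bounded_linear_bop_apply)
  have "\<exists>z. \<forall>y. cinner z y = cinner x (bop_apply A y)" for x
  proof -
    have "bounded_linear (\<lambda>y. inner x (bop_apply A y))"
      by (rule bounded_linear_compose[OF bounded_linear_inner_right A.bounded_linear_axioms])
    then obtain z where z: "\<And>y. inner x (bop_apply A y) = inner z y"
      using real_riesz by blast
    have "cinner z y = cinner x (bop_apply A y)" for y
      by (rule complex_eqI) (simp_all add: Re_cinner Im_cinner z flip: bop_apply_scaleC)
    then show ?thesis by blast
  qed
  then obtain B where B: "\<And>x y. cinner (B x) y = cinner x (bop_apply A y)" by metis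
  have add: "B (x + y) = B x + B y" for x y
    by (rule cinner_eqI) (simp add: B cinner_add_left)
  have scC: "B (c *\<^sub>C x) = c *\<^sub>C B x" for c x
    by (rule cinner_eqI) (simp add: B cinner_scaleC_left)
  have bd: "norm (B x) \<le> norm x * norm A" for x
  proof -
    have "(norm (B x))\<^sup>2 = cmod (cinner (B x) (B x))"
      by (simp add: cinner_self norm_power)
    also have "\<dots> \<le> norm x * norm (bop_apply A (B x))"
      unfolding B by (rule norm_cinner_le)
    also have "\<dots> \<le> norm x * (norm A * norm (B x))"
      by (intro mult_left_mono norm_bop_apply) simp
    finally show ?thesis
      by (cases "B x = 0") (auto simp: power2_eq_square)
  qed
  have "bounded_linear B"
  proof (rule bounded_linear_intro[OF add _ bd])
    show "B (r *\<^sub>R x) = r *\<^sub>R B x" for r x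
      using scC[of "complex_of_real r" x] by (simp add: scaleC_of_real)
  qed
  then have "bop_apply (Abs_bop (Blinfun B)) = B"
    by (simp add: bop_apply.rep_eq Abs_bop_inverse bounded_linear_Blinfun_apply scC)
  with B show ?thesis by metis
qed

instantiation bop :: ("{chilbert_space,perfect_space}") unital_cstar
begin

definition star_bop :: "'a bop \<Rightarrow> 'a bop" where
  "star_bop A = (THE B. \<forall>x y. cinner (bop_apply B x) y = cinner x (bop_apply A y))"

lemma cinner_star_bop: "cinner (bop_apply (star A) x) y = cinner x (bop_apply A y)"
proof -
  obtain B where B: "\<forall>x y. cinner (bop_apply B x) y = cinner x (bop_apply A y)"
    using adjoint_exists by blast
  have "\<forall>x y. cinner (bop_apply (star A) x) y = cinner x (bop_apply A y)"
    unfolding star_bop_def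
  proof (rule theI[where a=B])
    fix C assume C: "\<forall>x y. cinner (bop_apply C x) y = cinner x (bop_apply A y)"
    show "C = B"
      by (rule bop_eqI, rule cinner_eqI) (simp only: B[rule_format] C[rule_format])
  qed (rule B)
  then show ?thesis by blast
qed

lemma star_bopI: "(\<And>x y. cinner (bop_apply B x) y = cinner x (bop_apply A y)) \<Longrightarrow> star A = B"
  by (rule bop_eqI, rule cinner_eqI) (simp add: cinner_star_bop)

lemma cinner_star_bop': "cinner x (bop_apply (star A) y) = cinner (bop_apply A x) y"
proof -
  have "cinner x (bop_apply (star A) y) = cnj (cinner (bop_apply (star A) y) x)"
    by (rule cinner_commute)
  also have "\<dots> = cnj (cinner y (bop_apply A x))" by (simp only: cinner_star_bop)
  also have "\<dots> = cinner (bop_apply A x) y" by (rule cinner_commute[symmetric])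
  finally show ?thesis .
qed

instance
proof
  fix A B :: "'a bop" and a :: complex
  note [simp] = plus_bop_apply scaleC_bop_apply times_bop_apply bop_apply_scaleC
  show "a *\<^sub>C A * B = a *\<^sub>C (A * B)" "A * a *\<^sub>C B = a *\<^sub>C (A * B)"
    by (auto intro!: bop_eqI)
  show ss: "star (star A) = A" for A :: "'a bop"
    by (rule star_bopI) (simp add: cinner_star_bop')
  show "star (A + B) = star A + star B"
    by (rule star_bopI) (simp add: cinner_add_left cinner_add_right cinner_star_bop)
  show "star (a *\<^sub>C A) = cnj a *\<^sub>C star A"
    by (rule star_bopI) (simp add: cinner_scaleC_left cinner_scaleC_right cinner_star_bop)
  show "star (A * B) = star B * star A"
    by (rule star_bopI) (simp add: cinner_star_bop)
  have le: "(norm A)\<^sup>2 \<le> norm (star A * A)" for A :: "'a bop"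
  proof -
    have "norm A \<le> sqrt (norm (star A * A))"
    proof (rule norm_bop_bound)
      fix x
      have "(norm (bop_apply A x))\<^sup>2 = cmod (cinner (bop_apply (star A * A) x) x)"
        by (simp add: cinner_star_bop cinner_self norm_power)
      also have "\<dots> \<le> norm (star A * A) * norm x * norm x"
        by (rule order_trans[OF norm_cinner_le]) (intro mult_right_mono norm_bop_apply; simp)
      also have "\<dots> = (sqrt (norm (star A * A)) * norm x)\<^sup>2"
        by (simp add: power_mult_distrib power2_eq_square)
      finally show "norm (bop_apply A x) \<le> sqrt (norm (star A * A)) * norm x"
        by (rule power2_le_imp_le) simp
    qed simp
    then have "(norm A)\<^sup>2 \<le> (sqrt (norm (star A * A)))\<^sup>2"
      by (rule power_mono) simp
    then show ?thesis by simp
  qed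
  have ns: "norm A \<le> norm (star A)" for A :: "'a bop"
  proof (cases "A = 0")
    case False
    have "norm A * norm A \<le> norm (star A) * norm A"
      using le[of A] norm_mult_ineq[of "star A" A] by (simp only: power2_eq_square)
    then show ?thesis using False by (simp only: mult_le_cancel_right) auto
  qed simp
  have "norm (star A) = norm A" using ns[of A] ns[of "star A"] by (simp add: ss)
  then show "norm (star A * A) = (norm A)\<^sup>2"
    using le[of A] norm_mult_ineq[of "star A" A] by (simp add: power2_eq_square)
qed

end

section \<open>The unitization of the compact operators\<close>

definition compact_op :: "'h::chilbert_space bop \<Rightarrow> bool" where
  "compact_op A \<longleftrightarrow> compact (closure (bop_apply A ` ball 0 1))"

lemma bop_apply_diff: "bop_apply A (x - y) = bop_apply A x - bop_apply A y"
  by (rule linear_diff[OF bounded_linear.linear[OF bounded_linear_bop_apply]])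

lemma compact_op_iff:
  "compact_op A \<longleftrightarrow> (\<forall>e>0. \<exists>k. finite k \<and> bop_apply A ` ball 0 1 \<subseteq> (\<Union>x\<in>k. ball x e))"
proof -
  let ?S = "bop_apply A ` ball 0 1"
  have "(\<forall>e>0. \<exists>k. finite k \<and> closure ?S \<subseteq> (\<Union>x\<in>k. ball x e)) \<longleftrightarrow>
        (\<forall>e>0. \<exists>k. finite k \<and> ?S \<subseteq> (\<Union>x\<in>k. ball x e))" (is "?l \<longleftrightarrow> ?r")
  proof
    assume ?l then show ?r by (meson closure_subset subset_trans)
  next
    assume r: ?r
    show ?l
    proof (intro allI impI)
      fix e :: real assume "e > 0"
      then obtain k where k: "finite k" "?S \<subseteq> (\<Union>x\<in>k. ball x (e/2))"
        using r by (meson half_gt_zero)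
      then have "closure ?S \<subseteq> (\<Union>x\<in>k. cball x (e/2))"
        by (intro closure_minimal order_trans[OF k(2)] UN_mono ball_subset_cball closed_UN ballI)
          simp_all
      also have "\<dots> \<subseteq> (\<Union>x\<in>k. ball x e)"
        using \<open>e > 0\<close> by (intro UN_mono subset_refl) (auto simp: subset_iff)
      finally show "\<exists>k. finite k \<and> closure ?S \<subseteq> (\<Union>x\<in>k. ball x e)" using k(1) by blast
    qed
  qed
  then show ?thesis
    unfolding compact_op_def compact_eq_totally_bounded by (simp add: complete_eq_closed)
qed

lemma compact_op_I:
  assumes "\<And>e. e > 0 \<Longrightarrow> \<exists>k. finite k \<and> (\<forall>x. norm x < 1 \<longrightarrow> (\<exists>y\<in>k. dist y (bop_apply A x) < e))"
  shows "compact_op A"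
  unfolding compact_op_iff
proof (intro allI impI)
  fix e :: real assume "e > 0"
  from assms[OF this] obtain k where k: "finite k"
    "\<And>x. norm x < 1 \<Longrightarrow> \<exists>y\<in>k. dist y (bop_apply A x) < e"
    by blast
  have "bop_apply A ` ball 0 1 \<subseteq> (\<Union>x\<in>k. ball x e)"
    using k(2) by (simp add: image_subset_iff)
  with k(1) show "\<exists>k. finite k \<and> bop_apply A ` ball 0 1 \<subseteq> (\<Union>x\<in>k. ball x e)"
    by blast
qed

lemma compact_op_D:
  assumes "compact_op A" "e > 0"
  obtains k where "finite k" "\<And>x. norm x < 1 \<Longrightarrow> \<exists>y\<in>k. dist y (bop_apply A x) < e"
proof -
  obtain k where k: "finite k" "bop_apply A ` ball 0 1 \<subseteq> (\<Union>x\<in>k. ball x e)"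
    using assms unfolding compact_op_iff by blast
  have "\<exists>y\<in>k. dist y (bop_apply A x) < e" if "norm x < 1" for x
  proof -
    have "bop_apply A x \<in> bop_apply A ` ball 0 1" using that by (intro imageI) simp
    then have "bop_apply A x \<in> (\<Union>x\<in>k. ball x e)" by (rule subsetD[OF k(2)])
    then show ?thesis by simp
  qed
  with k(1) that show ?thesis by blast
qed

lemma compact_op_zero: "compact_op 0"
  by (rule compact_op_I, rule exI[of _ "{0}"]) simp

lemma compact_op_plus:
  assumes "compact_op A" "compact_op B" shows "compact_op (A + B)"
proof (rule compact_op_I)
  fix e :: real assume "e > 0"
  then have e2: "e/2 > 0" by simp
  obtain k where k: "finite k" "\<And>x. norm x < 1 \<Longrightarrow> \<exists>y\<in>k. dist y (bop_apply A x) < e/2"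
    using compact_op_D[OF assms(1) e2] by blast
  obtain l where l: "finite l" "\<And>x. norm x < 1 \<Longrightarrow> \<exists>y\<in>l. dist y (bop_apply B x) < e/2"
    using compact_op_D[OF assms(2) e2] by blast
  let ?k = "(\<lambda>(x,y). x + y) ` (k \<times> l)"
  have "\<exists>y\<in>?k. dist y (bop_apply (A + B) x) < e" if x: "norm x < 1" for x
  proof -
    obtain y z where "y \<in> k" "z \<in> l" "dist y (bop_apply A x) < e/2" "dist z (bop_apply B x) < e/2"
      using k(2)[OF x] l(2)[OF x] by blast
    moreover from this have "dist (y + z) (bop_apply (A + B) x) < e"
      using dist_triangle_add[of y z "bop_apply A x" "bop_apply B x"]
      by (simp add: plus_bop_apply)
    ultimately show ?thesis by (intro bexI[of _ "y + z"]) auto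
  qed
  then show "\<exists>k. finite k \<and> (\<forall>x. norm x < 1 \<longrightarrow> (\<exists>y\<in>k. dist y (bop_apply (A + B) x) < e))"
    using k(1) l(1) by (intro exI[of _ ?k]) auto
qed

lemma compact_op_mult_left:
  fixes A B :: "'h::{chilbert_space,perfect_space} bop"
  assumes "compact_op A" shows "compact_op (B * A)"
proof (rule compact_op_I)
  fix e :: real assume e: "e > 0"
  define d where "d = e / (norm B + 1)"
  have nB: "norm B + 1 > 0" using norm_ge_zero[of B] by linarith
  have d: "d > 0" using e nB by (simp add: d_def)
  obtain k where k: "finite k" "\<And>x. norm x < 1 \<Longrightarrow> \<exists>y\<in>k. dist y (bop_apply A x) < d"
    using compact_op_D[OF assms d] by blast
  have "\<exists>y\<in>bop_apply B ` k. dist y (bop_apply (B * A) x) < e" if x: "norm x < 1" for x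
  proof -
    obtain y where y: "y \<in> k" "dist y (bop_apply A x) < d" using k(2)[OF x] by blast
    have "dist (bop_apply B y) (bop_apply (B * A) x) = norm (bop_apply B (y - bop_apply A x))"
      by (simp add: dist_norm times_bop_apply bop_apply_diff)
    also have "\<dots> \<le> norm B * norm (y - bop_apply A x)" by (rule norm_bop_apply)
    also have "\<dots> \<le> (norm B + 1) * norm (y - bop_apply A x)" by (intro mult_right_mono) auto
    also have "\<dots> < (norm B + 1) * d"
      using y(2) nB by (simp add: dist_norm)
    also have "\<dots> = e" using nB by (simp add: d_def)
    finally show ?thesis using y(1) by blast
  qed
  then show "\<exists>k. finite k \<and> (\<forall>x. norm x < 1 \<longrightarrow> (\<exists>y\<in>k. dist y (bop_apply (B * A) x) < e))"
    using k(1) by (intro exI[of _ "bop_apply B ` k"]) auto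
qed

lemma compact_op_mult_right:
  fixes A B :: "'h::{chilbert_space,perfect_space} bop"
  assumes "compact_op A" shows "compact_op (A * B)"
proof (rule compact_op_I)
  fix e :: real assume e: "e > 0"
  define M where "M = norm B + 1"
  have M: "M > 0" "norm B < M" unfolding M_def using norm_ge_zero[of B] by linarith+
  interpret A: bounded_linear "bop_apply A" by (rule bounded_linear_bop_apply)
  interpret B: bounded_linear "bop_apply B" by (rule bounded_linear_bop_apply)
  have d: "e / M > 0" using e M by simp
  obtain k where k: "finite k" "\<And>x. norm x < 1 \<Longrightarrow> \<exists>y\<in>k. dist y (bop_apply A x) < e / M"
    using compact_op_D[OF assms d] by blast
  let ?k = "(\<lambda>y. M *\<^sub>R y) ` k"
  have "\<exists>y\<in>?k. dist y (bop_apply (A * B) x) < e" if x: "norm x < 1" for x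
  proof -
    have "norm (bop_apply B x) \<le> norm B * norm x" by (rule norm_bop_apply)
    also have "\<dots> \<le> norm B * 1" using x by (intro mult_left_mono) auto
    also have "\<dots> < M" using M by simp
    finally have "norm ((1/M) *\<^sub>R bop_apply B x) < 1" using M by simp
    then obtain y where y: "y \<in> k" "dist y (bop_apply A ((1/M) *\<^sub>R bop_apply B x)) < e / M"
      using k(2) by blast
    have "dist (M *\<^sub>R y) (bop_apply (A * B) x) = norm (M *\<^sub>R (y - bop_apply A ((1/M) *\<^sub>R bop_apply B x)))"
      using M by (simp add: dist_norm times_bop_apply A.scaleR scaleR_diff_right)
    also have "\<dots> = M * dist y (bop_apply A ((1/M) *\<^sub>R bop_apply B x))"
      using M by (simp add: dist_norm)
    also have "\<dots> < M * (e / M)" using y(2) M(1) by (intro mult_strict_left_mono)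
    also have "\<dots> = e" using M by simp
    finally show ?thesis using y(1) by blast
  qed
  then show "\<exists>k. finite k \<and> (\<forall>x. norm x < 1 \<longrightarrow> (\<exists>y\<in>k. dist y (bop_apply (A * B) x) < e))"
    using k(1) by (intro exI[of _ ?k]) auto
qed

lemma compact_op_scaleC:
  fixes A :: "'h::{chilbert_space,perfect_space} bop"
  assumes "compact_op A" shows "compact_op (c *\<^sub>C A)"
  using compact_op_mult_left[OF assms, of "c *\<^sub>C 1"] by (simp add: mult_scaleC_left)

lemma compact_op_minus:
  fixes A :: "'h::{chilbert_space,perfect_space} bop"
  assumes "compact_op A" shows "compact_op (- A)"
  using compact_op_scaleC[OF assms, of "-1"] by (simp add: scaleC_minus1)

lemma compact_op_star:
  fixes A :: "'h::{chilbert_space,perfect_space} bop"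
  assumes "compact_op A" shows "compact_op (star A)"
proof (rule compact_op_I)
  fix e :: real assume e: "e > 0"
  define d where "d = e\<^sup>2 / 5"
  have d: "d > 0" using e by (simp add: d_def)
  have c: "compact_op (A * star A)" by (rule compact_op_mult_right[OF assms])
  obtain k where k: "finite k" "\<And>x. norm x < 1 \<Longrightarrow> \<exists>y\<in>k. dist y (bop_apply (A * star A) x) < d"
    using compact_op_D[OF c d] by blast
  define P where "P y x \<longleftrightarrow> norm x < 1 \<and> dist y (bop_apply (A * star A) x) < d" for y x
  define g where "g y = bop_apply (star A) (SOME x. P y x)" for y
  have "\<exists>y\<in>g ` k. dist y (bop_apply (star A) x) < e" if x: "norm x < 1" for x
  proof -
    obtain y where y: "y \<in> k" "P y x" using k(2)[OF x] x by (auto simp: P_def)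
    define z where "z = (SOME x. P y x)"
    have z: "P y z" unfolding z_def by (rule someI[of "P y", OF y(2)])
    let ?w = "z - x"
    have zd: "norm z < 1" "dist y (bop_apply (A * star A) z) < d"
      and yd: "dist y (bop_apply (A * star A) x) < d"
      using z y(2) unfolding P_def by blast+
    have "norm (bop_apply (A * star A) ?w) = dist (bop_apply (A * star A) z) (bop_apply (A * star A) x)"
      unfolding dist_norm bop_apply_diff ..
    also have "\<dots> \<le> dist y (bop_apply (A * star A) z) + dist y (bop_apply (A * star A) x)"
      by (rule dist_triangle3)
    also have "\<dots> \<le> 2 * d" using zd yd by linarith
    finally have n1: "norm (bop_apply (A * star A) ?w) \<le> 2 * d" .
    have n2: "norm ?w \<le> 2" using zd x norm_triangle_ineq4[of z x] by linarith
    have "dist (g y) (bop_apply (star A) x) = norm (bop_apply (star A) ?w)"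
      unfolding g_def z_def[symmetric] dist_norm bop_apply_diff ..
    then have "(dist (g y) (bop_apply (star A) x))\<^sup>2
        = cmod (cinner (bop_apply (star A) ?w) (bop_apply (star A) ?w))"
      unfolding cinner_self norm_of_real by simp
    also have "\<dots> = cmod (cinner ?w (bop_apply (A * star A) ?w))"
      by (simp only: cinner_star_bop times_bop_apply)
    also have "\<dots> \<le> norm ?w * norm (bop_apply (A * star A) ?w)" by (rule norm_cinner_le)
    also have "\<dots> \<le> 2 * (2 * d)" by (rule mult_mono[OF n2 n1]) simp_all
    also have "\<dots> < e\<^sup>2" using d unfolding d_def by linarith
    finally have "dist (g y) (bop_apply (star A) x) < e"
      by (rule power_less_imp_less_base) (use e in simp)
    then show ?thesis using y(1) by blast
  qed
  then show "\<exists>k. finite k \<and> (\<forall>x. norm x < 1 \<longrightarrow> (\<exists>y\<in>k. dist y (bop_apply (star A) x) < e))"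
    using k(1) by (intro exI[of _ "g ` k"]) auto
qed

lemma closed_compact_op: "closed {A :: 'h::chilbert_space bop. compact_op A}"
proof (subst closed_sequential_limits, intro allI impI, elim conjE)
  fix X :: "nat \<Rightarrow> 'h bop" and L
  assume X: "\<forall>n. X n \<in> {A. compact_op A}" and lim: "X \<longlonglongrightarrow> L"
  have "compact_op L"
  proof (rule compact_op_I)
    fix e :: real assume "e > 0"
    then have e2: "e/2 > 0" by simp
    obtain n where n: "norm (X n - L) < e/2"
      using lim e2 unfolding lim_sequentially dist_norm by blast
    have "compact_op (X n)" using X by simp
    then obtain k where k: "finite k" "\<And>x. norm x < 1 \<Longrightarrow> \<exists>y\<in>k. dist y (bop_apply (X n) x) < e/2"
      using compact_op_D[OF _ e2] by blast
    have "\<exists>y\<in>k. dist y (bop_apply L x) < e" if x: "norm x < 1" for x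
    proof -
      obtain y where y: "y \<in> k" "dist y (bop_apply (X n) x) < e/2" using k(2)[OF x] by blast
      have "norm (bop_apply (X n) x - bop_apply L x) \<le> norm (X n - L) * norm x"
        using norm_bop_apply[of "X n - L" x] by (simp add: minus_bop_apply)
      also have "\<dots> \<le> norm (X n - L) * 1" using x by (intro mult_left_mono) auto
      finally have "dist (bop_apply (X n) x) (bop_apply L x) < e/2" using n by (simp add: dist_norm)
      then show ?thesis using y dist_triangle_half_r[of "bop_apply (X n) x" y e "bop_apply L x"]
        by (metis dist_commute)
    qed
    then show "\<exists>k. finite k \<and> (\<forall>x. norm x < 1 \<longrightarrow> (\<exists>y\<in>k. dist y (bop_apply L x) < e))"
      using k(1) by blast
  qed
  then show "L \<in> {A. compact_op A}" by simp
qed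

text \<open>The elements \<open>K + c1\<close> with \<open>K\<close> compact. On an infinite-dimensional \<open>H\<close> the
  representation is unique; on a finite-dimensional one the type is all of \<open>B(H)\<close>.
  (\<^class>\<open>perfect_space\<close> only excludes \<open>H = 0\<close>, where \<open>0 = 1\<close>.)\<close>

typedef (overloaded) 'h unitized_compacts =
  "{A :: 'h::{chilbert_space,perfect_space} bop. \<exists>K c. compact_op K \<and> A = K + c *\<^sub>C 1}"
  morphisms of_uc Abs_uc
proof
  show "0 \<in> {A :: 'h bop. \<exists>K c. compact_op K \<and> A = K + c *\<^sub>C 1}"
    unfolding mem_Collect_eq by (intro exI[of _ 0] conjI compact_op_zero) simp
qed

setup_lifting type_definition_unitized_compacts

lemma closed_range_of_uc:
  "closed {A :: 'h::{chilbert_space,perfect_space} bop. \<exists>K c. compact_op K \<and> A = K + c *\<^sub>C 1}"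
  (is "closed ?U")
proof (cases "compact_op (1 :: 'h bop)")
  case True
  have "?U = {A. compact_op A}"
  proof (intro set_eqI iffI)
    fix A :: "'h bop" assume "A \<in> {A. compact_op A}"
    then show "A \<in> ?U"
      unfolding mem_Collect_eq by (intro exI[of _ A] exI[of _ 0] conjI) simp_all
  next
    fix A :: "'h bop" assume "A \<in> ?U"
    then obtain K c where "compact_op K" "A = K + c *\<^sub>C 1" by blast
    then show "A \<in> {A. compact_op A}"
      using compact_op_plus[OF _ compact_op_scaleC[OF True]] by simp
  qed
  then show ?thesis by (simp only: closed_compact_op)
next
  case False
  have "open (- {A :: 'h bop. compact_op A})" by (intro open_Compl closed_compact_op)
  moreover have "(1::'h bop) \<in> - {A. compact_op A}" using False by simp
  ultimately obtain d where d: "d > 0" "ball (1::'h bop) d \<subseteq> - {A. compact_op A}"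
    by (rule openE)
  have ge: "cmod c * d \<le> norm (K + c *\<^sub>C 1)" if "compact_op K" for K :: "'h bop" and c
  proof (cases "c = 0")
    case False
    let ?K = "(- 1 / c) *\<^sub>C K"
    have "compact_op ?K" by (rule compact_op_scaleC[OF that])
    then have "?K \<notin> ball 1 d" using d(2) by blast
    then have "d \<le> norm (1 - ?K)" by (simp only: mem_ball dist_norm not_less)
    then have "cmod c * d \<le> norm (c *\<^sub>C (1 - ?K))"
      unfolding norm_scaleC by (rule mult_left_mono) simp
    also have "c *\<^sub>C ?K = - K"
      using False by (simp only: scaleC_scaleC) (simp add: scaleC_minus1)
    then have "c *\<^sub>C (1 - ?K) = K + c *\<^sub>C 1"
      by (simp only: scaleC_diff_right) (simp only: diff_minus_eq_add add.commute)
    finally show ?thesis .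
  qed simp
  show ?thesis
  proof (subst closed_sequential_limits, intro allI impI, elim conjE)
    fix X :: "nat \<Rightarrow> 'h bop" and L
    assume X: "\<forall>n. X n \<in> ?U" and lim: "X \<longlonglongrightarrow> L"
    have "\<forall>n. \<exists>p. compact_op (fst p) \<and> X n = fst p + snd p *\<^sub>C 1"
    proof
      fix n
      obtain K c where "compact_op K" "X n = K + c *\<^sub>C 1" using X by blast
      then show "\<exists>p. compact_op (fst p) \<and> X n = fst p + snd p *\<^sub>C 1"
        by (intro exI[of _ "(K, c)"]) simp
    qed
    from choice[OF this]
    obtain p where p: "\<forall>n. compact_op (fst (p n)) \<and> X n = fst (p n) + snd (p n) *\<^sub>C 1"
      by (rule exE)
    define K c where "K n = fst (p n)" and "c n = snd (p n)" for n
    have K: "compact_op (K n)" and c: "X n = K n + c n *\<^sub>C 1" for n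
      using p unfolding K_def c_def by blast+
    have "Cauchy c"
    proof (rule metric_CauchyI)
      fix e :: real assume "e > 0"
      then have "e * d > 0" using d by simp
      then obtain M where M: "\<And>m n. m \<ge> M \<Longrightarrow> n \<ge> M \<Longrightarrow> norm (X m - X n) < e * d"
        using LIMSEQ_imp_Cauchy[OF lim] unfolding Cauchy_def dist_norm by meson
      have "dist (c m) (c n) < e" if "m \<ge> M" "n \<ge> M" for m n
      proof -
        have "X m - X n = (K m + - K n) + (c m - c n) *\<^sub>C 1"
          by (simp only: c scaleC_diff_left) simp
        then have "cmod (c m - c n) * d \<le> norm (X m - X n)"
          using ge[OF compact_op_plus[OF K compact_op_minus[OF K]]] by (simp only:)
        also have "\<dots> < e * d" using M that by blast
        finally show ?thesis using d by (simp add: dist_norm)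
      qed
      then show "\<exists>M. \<forall>m\<ge>M. \<forall>n\<ge>M. dist (c m) (c n) < e" by blast
    qed
    then obtain c0 where c0: "c \<longlonglongrightarrow> c0" by (meson Cauchy_convergent convergentD)
    have "(\<lambda>n. X n - c n *\<^sub>C 1) \<longlonglongrightarrow> L - c0 *\<^sub>C 1"
      by (intro tendsto_diff lim bounded_linear.tendsto[OF bounded_linear_scaleC_left c0])
    moreover have "(\<lambda>n. X n - c n *\<^sub>C 1) = K" by (rule ext) (simp only: c add_diff_cancel_right')
    ultimately have "K \<longlonglongrightarrow> L - c0 *\<^sub>C 1" by (simp only:)
    then have "compact_op (L - c0 *\<^sub>C 1)"
      using closed_compact_op K unfolding closed_sequential_limits by blast
    then show "L \<in> ?U"
      unfolding mem_Collect_eq by (intro exI[of _ "L - c0 *\<^sub>C 1"] exI[of _ c0] conjI) simp_all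
  qed
qed

lemma uc_mult:
  fixes K L :: "'h::{chilbert_space,perfect_space} bop"
  assumes "compact_op K" "compact_op L"
  shows "\<exists>M e. compact_op M \<and> (K + c *\<^sub>C 1) * (L + d *\<^sub>C 1) = M + e *\<^sub>C 1"
proof (intro exI conjI)
  show "compact_op (K * L + d *\<^sub>C K + c *\<^sub>C L)"
    by (intro compact_op_plus compact_op_mult_left compact_op_scaleC assms)
  show "(K + c *\<^sub>C 1) * (L + d *\<^sub>C 1) = (K * L + d *\<^sub>C K + c *\<^sub>C L) + (c * d) *\<^sub>C 1"
    by (simp only: distrib_left distrib_right mult_scaleC_left mult_scaleC_right scaleC_scaleC
        scaleC_add_right mult_1_left mult_1_right mult.commute[of d c] add_ac)
qed

lemma star_one: "star (1::'a::unital_cstar) = 1"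
proof -
  have "star (1::'a) = star 1 * star (star 1)" by (simp add: star_star)
  also have "\<dots> = star (star 1 * 1)" by (simp only: star_mult)
  also have "\<dots> = 1" by (simp add: star_star)
  finally show ?thesis .
qed

instantiation unitized_compacts :: ("{chilbert_space,perfect_space}") complex_normed_vector
begin

lift_definition zero_unitized_compacts :: "'a unitized_compacts" is 0
  by (intro exI[of _ 0]) (simp add: compact_op_zero)
lift_definition plus_unitized_compacts ::
  "'a unitized_compacts \<Rightarrow> 'a unitized_compacts \<Rightarrow> 'a unitized_compacts" is "(+)"
proof (elim exE conjE)
  fix A B K L :: "'a bop" and c d
  assume "compact_op K" "compact_op L" "A = K + c *\<^sub>C 1" "B = L + d *\<^sub>C 1"
  then have "compact_op (K + L) \<and> A + B = (K + L) + (c + d) *\<^sub>C 1"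
    by (simp add: compact_op_plus scaleC_add_left)
  then show "\<exists>K c. compact_op K \<and> A + B = K + c *\<^sub>C 1" by blast
qed
lift_definition scaleC_unitized_compacts ::
  "complex \<Rightarrow> 'a unitized_compacts \<Rightarrow> 'a unitized_compacts" is scaleC
proof (elim exE conjE)
  fix A K :: "'a bop" and a c
  assume "compact_op K" "A = K + c *\<^sub>C 1"
  then have "compact_op (a *\<^sub>C K) \<and> a *\<^sub>C A = a *\<^sub>C K + (a * c) *\<^sub>C 1"
    by (simp add: compact_op_scaleC scaleC_add_right scaleC_scaleC)
  then show "\<exists>K c. compact_op K \<and> a *\<^sub>C A = K + c *\<^sub>C 1" by blast
qed
lift_definition uminus_unitized_compacts :: "'a unitized_compacts \<Rightarrow> 'a unitized_compacts" is uminus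
proof (elim exE conjE)
  fix A K :: "'a bop" and c
  assume "compact_op K" "A = K + c *\<^sub>C 1"
  then have "compact_op (- K) \<and> - A = - K + (- c) *\<^sub>C 1"
    using scaleC_diff_left[of 0 c "1::'a bop"] by (simp add: compact_op_minus)
  then show "\<exists>K c. compact_op K \<and> - A = K + c *\<^sub>C 1" by blast
qed
lift_definition minus_unitized_compacts ::
  "'a unitized_compacts \<Rightarrow> 'a unitized_compacts \<Rightarrow> 'a unitized_compacts" is "(-)"
proof (elim exE conjE)
  fix A B K L :: "'a bop" and c d
  assume "compact_op K" "compact_op L" "A = K + c *\<^sub>C 1" "B = L + d *\<^sub>C 1"
  then have "compact_op (K + - L) \<and> A - B = (K + - L) + (c - d) *\<^sub>C 1"
    using compact_op_plus[OF _ compact_op_minus, of K L] by (simp add: scaleC_diff_left)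
  then show "\<exists>K c. compact_op K \<and> A - B = K + c *\<^sub>C 1" by blast
qed
definition scaleR_unitized_compacts ::
  "real \<Rightarrow> 'a unitized_compacts \<Rightarrow> 'a unitized_compacts" where
  "scaleR_unitized_compacts r A = complex_of_real r *\<^sub>C A"
lift_definition norm_unitized_compacts :: "'a unitized_compacts \<Rightarrow> real" is norm .
lift_definition dist_unitized_compacts ::
  "'a unitized_compacts \<Rightarrow> 'a unitized_compacts \<Rightarrow> real" is dist .
definition sgn_unitized_compacts :: "'a unitized_compacts \<Rightarrow> 'a unitized_compacts" where
  "sgn_unitized_compacts A = scaleR (inverse (norm A)) A"
definition uniformity_unitized_compacts ::
  "('a unitized_compacts \<times> 'a unitized_compacts) filter" where
  "uniformity_unitized_compacts = (INF e\<in>{0<..}. principal {(x, y). dist x y < e})"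
definition open_unitized_compacts :: "'a unitized_compacts set \<Rightarrow> bool" where
  "open_unitized_compacts S = (\<forall>x\<in>S. \<forall>\<^sub>F (x', y) in uniformity. x' = x \<longrightarrow> y \<in> S)"

lemma of_uc_scaleR: "of_uc (r *\<^sub>R A) = r *\<^sub>R of_uc A"
  by (simp add: scaleR_unitized_compacts_def scaleC_unitized_compacts.rep_eq scaleC_of_real)

instance
proof
  fix A B C :: "'a unitized_compacts" and a b :: complex and r s :: real
  note [simp] = plus_unitized_compacts.rep_eq scaleC_unitized_compacts.rep_eq of_uc_scaleR
    norm_unitized_compacts.rep_eq
  show "A + B + C = A + (B + C)" by transfer simp
  show "A + B = B + A" by transfer simp
  show "0 + A = A" by transfer simp
  show "- A + A = 0" by transfer simp
  show "A - B = A + - B" by transfer simp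
  show "dist A B = norm (A - B)" by transfer (simp add: dist_norm)
  show "sgn A = inverse (norm A) *\<^sub>R A" by (simp add: sgn_unitized_compacts_def)
  show "uniformity = (INF e\<in>{0<..}. principal {(x, y). dist (x::'a unitized_compacts) y < e})"
    by (rule uniformity_unitized_compacts_def)
  show "open S = (\<forall>x\<in>S. \<forall>\<^sub>F (x', y) in uniformity. x' = x \<longrightarrow> y \<in> S)"
    for S :: "'a unitized_compacts set"
    by (rule open_unitized_compacts_def)
  show "(norm A = 0) = (A = 0)" by transfer simp
  show "norm (A + B) \<le> norm A + norm B" by (simp add: norm_triangle_ineq)
  show "r *\<^sub>R (A + B) = r *\<^sub>R A + r *\<^sub>R B" "(r + s) *\<^sub>R A = r *\<^sub>R A + s *\<^sub>R A"
    "r *\<^sub>R s *\<^sub>R A = (r * s) *\<^sub>R A" "1 *\<^sub>R A = A" "norm (r *\<^sub>R A) = \<bar>r\<bar> * norm A"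
    by (simp_all flip: of_uc_inject add: scaleR_add_right scaleR_add_left)
  show "a *\<^sub>C (A + B) = a *\<^sub>C A + a *\<^sub>C B" "(a + b) *\<^sub>C A = a *\<^sub>C A + b *\<^sub>C A"
    "a *\<^sub>C b *\<^sub>C A = (a * b) *\<^sub>C A" "complex_of_real r *\<^sub>C A = r *\<^sub>R A"
    "norm (a *\<^sub>C A) = cmod a * norm A"
    by (simp_all flip: of_uc_inject add: scaleC_add_right scaleC_add_left scaleC_scaleC
        scaleC_of_real norm_scaleC)
qed

end

instance unitized_compacts :: ("{chilbert_space,perfect_space}") banach
proof
  fix X :: "nat \<Rightarrow> 'a unitized_compacts" assume "Cauchy X"
  then have "Cauchy (\<lambda>n. of_uc (X n))"
    unfolding Cauchy_def dist_unitized_compacts.rep_eq .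
  then obtain L where L: "(\<lambda>n. of_uc (X n)) \<longlonglongrightarrow> L"
    by (meson Cauchy_convergent convergentD)
  have "L \<in> {A. \<exists>K c. compact_op K \<and> A = K + c *\<^sub>C 1}"
    by (rule closed_sequentially[OF closed_range_of_uc _ L]) (rule of_uc)
  then have "of_uc (Abs_uc L) = L" by (rule Abs_uc_inverse)
  then have "X \<longlonglongrightarrow> Abs_uc L"
    using L by (simp add: lim_sequentially dist_unitized_compacts.rep_eq)
  then show "convergent X" by (auto simp: convergent_def)
qed

instantiation unitized_compacts :: ("{chilbert_space,perfect_space}") unital_cstar
begin

lift_definition one_unitized_compacts :: "'a unitized_compacts" is 1
  by (intro exI[of _ 0] exI[of _ 1]) (simp add: compact_op_zero)
lift_definition times_unitized_compacts ::
  "'a unitized_compacts \<Rightarrow> 'a unitized_compacts \<Rightarrow> 'a unitized_compacts" is "(*)"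
proof (elim exE conjE)
  fix A B K L :: "'a bop" and c d
  assume KL: "compact_op K" "compact_op L" and "A = K + c *\<^sub>C 1" "B = L + d *\<^sub>C 1"
  then show "\<exists>K c. compact_op K \<and> A * B = K + c *\<^sub>C 1"
    by (simp only: uc_mult)
qed
lift_definition star_unitized_compacts :: "'a unitized_compacts \<Rightarrow> 'a unitized_compacts" is star
proof (elim exE conjE)
  fix A K :: "'a bop" and c
  assume "compact_op K" "A = K + c *\<^sub>C 1"
  then have "compact_op (star K) \<and> star A = star K + cnj c *\<^sub>C 1"
    by (simp add: compact_op_star star_add star_scaleC star_one)
  then show "\<exists>K c. compact_op K \<and> star A = K + c *\<^sub>C 1" by blast
qed

instance
proof
  fix A B C :: "'a unitized_compacts" and a :: complex and r :: real
  note [simp] = plus_unitized_compacts.rep_eq times_unitized_compacts.rep_eq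
    scaleC_unitized_compacts.rep_eq of_uc_scaleR star_unitized_compacts.rep_eq
    norm_unitized_compacts.rep_eq
  show "A * B * C = A * (B * C)" "(A + B) * C = A * C + B * C" "A * (B + C) = A * B + A * C"
    by (simp_all flip: of_uc_inject add: distrib_left distrib_right mult.assoc)
  show "1 * A = A" "A * 1 = A" by (transfer, simp)+
  show "r *\<^sub>R A * B = r *\<^sub>R (A * B)" "A * r *\<^sub>R B = r *\<^sub>R (A * B)"
    by (simp_all flip: of_uc_inject)
  show "norm (A * B) \<le> norm A * norm B" by (simp add: norm_mult_ineq)
  show n1: "norm (1 :: 'a unitized_compacts) = 1" by transfer simp
  show "(0::'a unitized_compacts) \<noteq> 1" by transfer simp
  show "a *\<^sub>C A * B = a *\<^sub>C (A * B)" "A * a *\<^sub>C B = a *\<^sub>C (A * B)" "star (star A) = A"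
    "star (A + B) = star A + star B" "star (a *\<^sub>C A) = cnj a *\<^sub>C star A"
    "star (A * B) = star B * star A"
    by (simp_all flip: of_uc_inject add: mult_scaleC_left mult_scaleC_right star_star star_add
        star_scaleC star_mult)
  show "norm (star A * A) = (norm A)\<^sup>2" by (simp add: cstar_identity)
qed

end

text \<open>The automorphisms \<open>b \<mapsto> e\<^bsup>ith\<^esup> b e\<^bsup>-ith\<^esup>\<close>. They leave the unitized compacts
  invariant because the compacts are an ideal, so that \<open>Abs_uc\<close> is applied inside its domain.\<close>

definition conj_semigroup ::
  "'h::{chilbert_space,perfect_space} bop \<Rightarrow> real \<Rightarrow> 'h unitized_compacts \<Rightarrow> 'h unitized_compacts"
  where "conj_semigroup h t b =
    Abs_uc (exp ((\<i> * t) *\<^sub>C h) * of_uc b * exp ((- \<i> * t) *\<^sub>C h))"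

lemma of_uc_conj_semigroup:
  "of_uc (conj_semigroup h t b) = exp ((\<i> * t) *\<^sub>C h) * of_uc b * exp ((- \<i> * t) *\<^sub>C h)"
proof -
  let ?x = "(\<i> * t) *\<^sub>C h"
  have m: "(- \<i> * t) *\<^sub>C h = - ?x"
    using scaleC_diff_left[of 0 "\<i> * t" h] by simp
  have "of_uc b \<in> {A. \<exists>K c. compact_op K \<and> A = K + c *\<^sub>C 1}" by (rule of_uc)
  then obtain K c where K: "compact_op K" and b: "of_uc b = K + c *\<^sub>C 1"
    unfolding mem_Collect_eq by (elim exE conjE)
  have "compact_op (exp ?x * K * exp (- ?x))"
    by (intro compact_op_mult_left compact_op_mult_right K)
  moreover have "exp ?x * of_uc b * exp (- ?x) = exp ?x * K * exp (- ?x) + c *\<^sub>C 1"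
    by (simp only: b distrib_left distrib_right mult_scaleC_left mult_scaleC_right
        mult_1_right exp_minus_inverse)
  ultimately have "exp ?x * of_uc b * exp (- ?x) \<in> {A. \<exists>K c. compact_op K \<and> A = K + c *\<^sub>C 1}"
    unfolding mem_Collect_eq by (intro exI conjI)
  then show ?thesis unfolding conj_semigroup_def m by (rule Abs_uc_inverse)
qed

section \<open>CP-semigroups\<close>

definition positive :: "'b::unital_cstar \<Rightarrow> bool" where
  "positive b \<longleftrightarrow> (\<exists>a. b = star a * a)"

text \<open>Matrices over the algebra are functions on pairs of indices below \<open>n\<close>. The positive elements of
  the \<open>C\<^sup>*\<close>-algebra of \<open>n \<times> n\<close>-matrices are those of the form \<open>X\<^sup>*X\<close>; a map is completely
  positive if all its entrywise applications to matrices preserve positivity.\<close>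

definition completely_positive :: "('b::unital_cstar \<Rightarrow> 'b) \<Rightarrow> bool" where
  "completely_positive T \<longleftrightarrow>
     (\<forall>a b. T (a + b) = T a + T b) \<and> (\<forall>c a. T (c *\<^sub>C a) = c *\<^sub>C T a) \<and>
     (\<forall>n. \<forall>X :: nat \<Rightarrow> nat \<Rightarrow> 'b. \<exists>Y :: nat \<Rightarrow> nat \<Rightarrow> 'b. \<forall>i<n. \<forall>j<n.
        T (\<Sum>k<n. star (X k i) * X k j) = (\<Sum>k<n. star (Y k i) * Y k j))"

text \<open>Only parameters \<open>t \<ge> 0\<close> matter in all families indexed by type \<^typ>\<open>real\<close>.\<close>

definition cp_semigroup :: "(real \<Rightarrow> 'b::unital_cstar \<Rightarrow> 'b) \<Rightarrow> bool" where
  "cp_semigroup T \<longleftrightarrow>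
     (\<forall>t\<ge>0. completely_positive (T t)) \<and> (\<forall>b. T 0 b = b) \<and>
     (\<forall>s\<ge>0. \<forall>t\<ge>0. \<forall>b. T (s + t) b = T s (T t b))"

definition markov_semigroup :: "(real \<Rightarrow> 'b::unital_cstar \<Rightarrow> 'b) \<Rightarrow> bool" where
  "markov_semigroup T \<longleftrightarrow> cp_semigroup T \<and> (\<forall>t\<ge>0. T t 1 = 1)"

definition uniformly_cont :: "(real \<Rightarrow> 'b::unital_cstar \<Rightarrow> 'b) \<Rightarrow> bool" where
  "uniformly_cont T \<longleftrightarrow>
     (\<forall>t\<ge>0. bounded_linear (T t)) \<and>
     (\<forall>t\<ge>0. ((\<lambda>s. onorm (\<lambda>b. T s b - T t b)) \<longlongrightarrow> 0) (at t within {0..}))"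

text \<open>Spatiality is a notion for strongly continuous CP-semigroups \<open>T\<close>; these properties of \<open>T\<close>
  are not repeated in the definition.\<close>

definition spatial :: "(real \<Rightarrow> 'b::unital_cstar \<Rightarrow> 'b) \<Rightarrow> bool" where
  "spatial T \<longleftrightarrow> (\<exists>c :: real \<Rightarrow> 'b.
     continuous_on {0..} c \<and> c 0 = 1 \<and> (\<forall>s\<ge>0. \<forall>t\<ge>0. c s * c t = c (s + t)) \<and>
     (\<forall>t\<ge>0. completely_positive (\<lambda>b. T t b - star (c t) * b * c t)))"

section \<open>Correspondences\<close>

text \<open>The underlying additive group is that of the ambient type. Complex scalars act through the
  unit of the algebra.\<close>

record ('b, 'e) corr =
  car :: "'e set"
  ip :: "'e \<Rightarrow> 'e \<Rightarrow> 'b"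
  lact :: "'b \<Rightarrow> 'e \<Rightarrow> 'e"
  ract :: "'e \<Rightarrow> 'b \<Rightarrow> 'e"

definition mnorm :: "('b::unital_cstar, 'e) corr \<Rightarrow> 'e \<Rightarrow> real" where
  "mnorm E x = sqrt (norm (ip E x x))"

definition hilbert_module :: "('b::unital_cstar, 'e::ab_group_add) corr \<Rightarrow> bool" where
  "hilbert_module E \<longleftrightarrow>
     0 \<in> car E \<and> (\<forall>x\<in>car E. \<forall>y\<in>car E. x - y \<in> car E) \<and>
     (\<forall>x\<in>car E. \<forall>b. ract E x b \<in> car E) \<and>
     (\<forall>x\<in>car E. \<forall>y\<in>car E. \<forall>b. ract E (x + y) b = ract E x b + ract E y b) \<and>
     (\<forall>x\<in>car E. \<forall>a b. ract E x (a + b) = ract E x a + ract E x b) \<and>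
     (\<forall>x\<in>car E. \<forall>a b. ract E x (a * b) = ract E (ract E x a) b) \<and>
     (\<forall>x\<in>car E. ract E x 1 = x) \<and>
     (\<forall>x\<in>car E. \<forall>y\<in>car E. \<forall>z\<in>car E. ip E x (y + z) = ip E x y + ip E x z) \<and>
     (\<forall>x\<in>car E. \<forall>y\<in>car E. \<forall>b. ip E x (ract E y b) = ip E x y * b) \<and>
     (\<forall>x\<in>car E. \<forall>y\<in>car E. ip E y x = star (ip E x y)) \<and>
     (\<forall>x\<in>car E. positive (ip E x x) \<and> (ip E x x = 0 \<longrightarrow> x = 0)) \<and>
     (\<forall>X. (\<forall>n::nat. X n \<in> car E) \<and>
           (\<forall>e>0. \<exists>N. \<forall>m\<ge>N. \<forall>n\<ge>N. mnorm E (X m - X n) < e) \<longrightarrow>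
           (\<exists>x\<in>car E. (\<lambda>n. mnorm E (X n - x)) \<longlonglongrightarrow> 0))"

definition correspondence :: "('b::unital_cstar, 'e::ab_group_add) corr \<Rightarrow> bool" where
  "correspondence E \<longleftrightarrow> hilbert_module E \<and>
     (\<forall>x\<in>car E. \<forall>b. lact E b x \<in> car E) \<and>
     (\<forall>x\<in>car E. \<forall>y\<in>car E. \<forall>b. lact E b (x + y) = lact E b x + lact E b y) \<and>
     (\<forall>x\<in>car E. \<forall>b c. lact E b (ract E x c) = ract E (lact E b x) c) \<and>
     (\<forall>x\<in>car E. \<forall>y\<in>car E. \<forall>b. ip E x (lact E b y) = ip E (lact E (star b) x) y) \<and>
     (\<forall>x\<in>car E. \<forall>a b. lact E (a + b) x = lact E a x + lact E b x) \<and>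
     (\<forall>x\<in>car E. \<forall>a c. lact E (c *\<^sub>C a) x = ract E (lact E a x) (c *\<^sub>C 1)) \<and>
     (\<forall>x\<in>car E. \<forall>a b. lact E (a * b) x = lact E a (lact E b x)) \<and>
     (\<forall>x\<in>car E. lact E 1 x = x)"

definition bilinear_isometry ::
  "('b::unital_cstar, 'e::ab_group_add) corr \<Rightarrow> ('b, 'g::ab_group_add) corr \<Rightarrow> ('e \<Rightarrow> 'g) \<Rightarrow> bool" where
  "bilinear_isometry E G v \<longleftrightarrow>
     (\<forall>x\<in>car E. v x \<in> car G) \<and>
     (\<forall>x\<in>car E. \<forall>y\<in>car E. v (x + y) = v x + v y) \<and>
     (\<forall>x\<in>car E. \<forall>b. v (lact E b x) = lact G b (v x)) \<and>
     (\<forall>x\<in>car E. \<forall>b. v (ract E x b) = ract G (v x) b) \<and>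
     (\<forall>x\<in>car E. \<forall>y\<in>car E. ip G (v x) (v y) = ip E x y)"

definition bilinear_unitary ::
  "('b::unital_cstar, 'e::ab_group_add) corr \<Rightarrow> ('b, 'g::ab_group_add) corr \<Rightarrow> ('e \<Rightarrow> 'g) \<Rightarrow> bool" where
  "bilinear_unitary E G v \<longleftrightarrow> bilinear_isometry E G v \<and> v ` car E = car G"

text \<open>The algebra as a correspondence over itself.\<close>

definition trivial_corr :: "('b::unital_cstar, 'b) corr" where
  "trivial_corr = \<lparr>car = UNIV, ip = (\<lambda>x y. star x * y), lact = (*), ract = (*)\<rparr>"

subsection \<open>Completions\<close>

text \<open>All completions below are instances of one construction. Let \<open>S\<close> be a set and
  \<open>K\<close> an algebra-valued positive definite kernel on \<open>S\<close>. The free right module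
  of all finite formal sums \<open>\<Sum> s \<cdot> c s\<close> carries the semi-inner product given by \<open>K\<close>; its
  separated completion \<open>M\<close> is realised here inside the functions on \<open>S\<close>, an element
  \<open>\<phi>\<close> of \<open>M\<close> being represented by the function \<open>s \<mapsto> \<langle>s, \<phi>\<rangle>\<close> (set to \<open>0\<close> off \<open>S\<close>).
  The elements of \<open>M\<close> are the limits of Cauchy sequences \<open>c\<close> of formal sums.
  The parameter \<open>L\<close> describes the left action.\<close>

definition formal_sums :: "'s set \<Rightarrow> ('s \<Rightarrow> 'b::unital_cstar) set" where
  "formal_sums S = {c. finite {s. c s \<noteq> 0} \<and> {s. c s \<noteq> 0} \<subseteq> S}"

definition kernel_ip ::
  "('s \<Rightarrow> 's \<Rightarrow> 'b) \<Rightarrow> ('s \<Rightarrow> 'b::unital_cstar) \<Rightarrow> ('s \<Rightarrow> 'b) \<Rightarrow> 'b" where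
  "kernel_ip K c d = (\<Sum>r | c r \<noteq> 0. \<Sum>s | d s \<noteq> 0. star (c r) * K r s * d s)"

definition represents ::
  "'s set \<Rightarrow> ('s \<Rightarrow> 's \<Rightarrow> 'b) \<Rightarrow> (nat \<Rightarrow> 's \<Rightarrow> 'b::unital_cstar) \<Rightarrow> ('s \<Rightarrow> 'b) \<Rightarrow> bool" where
  "represents S K c \<phi> \<longleftrightarrow>
     (\<forall>n. c n \<in> formal_sums S) \<and>
     (\<forall>e>0. \<exists>N. \<forall>m\<ge>N. \<forall>n\<ge>N. norm (kernel_ip K (c m - c n) (c m - c n)) < e) \<and>
     (\<forall>s\<in>S. (\<lambda>n. \<Sum>r | c n r \<noteq> 0. K s r * c n r) \<longlonglongrightarrow> \<phi> s) \<and>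
     (\<forall>s. s \<notin> S \<longrightarrow> \<phi> s = 0)"

definition kernel_module ::
  "'s set \<Rightarrow> ('s \<Rightarrow> 's \<Rightarrow> 'b) \<Rightarrow> ('b \<Rightarrow> ('s \<Rightarrow> 'b) \<Rightarrow> 's \<Rightarrow> 'b) \<Rightarrow>
    ('b::unital_cstar, 's \<Rightarrow> 'b) corr" where
  "kernel_module S K L = \<lparr>
     car = {\<phi>. \<exists>c. represents S K c \<phi>},
     ip = (\<lambda>\<phi> \<psi>. let c = SOME c. represents S K c \<phi> in
             lim (\<lambda>n. \<Sum>s | c n s \<noteq> 0. star (c n s) * \<psi> s)),
     lact = (\<lambda>b \<phi> s. if s \<in> S then L b \<phi> s else 0),
     ract = (\<lambda>\<phi> b s. \<phi> s * b)\<rparr>"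

definition class_of :: "'s set \<Rightarrow> ('s \<Rightarrow> 's \<Rightarrow> 'b) \<Rightarrow> 's \<Rightarrow> 's \<Rightarrow> 'b::unital_cstar" where
  "class_of S K s = (\<lambda>r. if r \<in> S then K r s else 0)"

subsection \<open>Internal tensor products\<close>

definition tensor_kernel ::
  "('b, 'e) corr \<Rightarrow> ('b, 'g) corr \<Rightarrow> 'e \<times> 'g \<Rightarrow> 'e \<times> 'g \<Rightarrow> 'b" where
  "tensor_kernel E G = (\<lambda>(x, y) (x', y'). ip G y (lact G (ip E x x') y'))"

definition tensor ::
  "('b::unital_cstar, 'e) corr \<Rightarrow> ('b, 'g) corr \<Rightarrow> ('b, 'e \<times> 'g \<Rightarrow> 'b) corr" where
  "tensor E G = kernel_module (car E \<times> car G) (tensor_kernel E G)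
     (\<lambda>b \<phi> (x, y). \<phi> (lact E (star b) x, y))"

definition elem_tensor ::
  "('b::unital_cstar, 'e) corr \<Rightarrow> ('b, 'g) corr \<Rightarrow> 'e \<Rightarrow> 'g \<Rightarrow> 'e \<times> 'g \<Rightarrow> 'b" where
  "elem_tensor E G x y = class_of (car E \<times> car G) (tensor_kernel E G) (x, y)"

text \<open>Tensor powers: the list \<open>[x\<^sub>n, \<dots>, x\<^sub>1]\<close> stands for \<open>x\<^sub>n \<odot> \<dots> \<odot> x\<^sub>1\<close>, and
  \<open>power_kernel E b xs ys = \<langle>xs, b ys\<rangle>\<close>. The power with exponent \<open>0\<close> is the algebra, the empty list
  standing for its unit.\<close>

fun power_kernel :: "('b::unital_cstar, 'e) corr \<Rightarrow> 'b \<Rightarrow> 'e list \<Rightarrow> 'e list \<Rightarrow> 'b" where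
  "power_kernel E b [] [] = b"
| "power_kernel E b (x # xs) (y # ys) = power_kernel E (ip E x (lact E b y)) xs ys"
| "power_kernel E b _ _ = 0"

definition tensor_power :: "('b::unital_cstar, 'e) corr \<Rightarrow> nat \<Rightarrow> ('b, 'e list \<Rightarrow> 'b) corr" where
  "tensor_power E n = kernel_module {xs. length xs = n \<and> set xs \<subseteq> car E} (power_kernel E 1)
     (\<lambda>b \<phi> xs. case xs of [] \<Rightarrow> b * \<phi> [] | x # xs' \<Rightarrow> \<phi> (lact E (star b) x # xs'))"

section \<open>Product systems\<close>

text \<open>\<open>mul E s t\<close> is the product \<open>(x, y) \<mapsto> u\<^bsub>s,t\<^esub>(x \<odot> y)\<close>, and \<open>of_alg E\<close> is the identification of
  the algebra with the fibre at \<open>0\<close>.\<close>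

record ('b, 'e) psys =
  fib :: "real \<Rightarrow> ('b, 'e) corr"
  mul :: "real \<Rightarrow> real \<Rightarrow> 'e \<Rightarrow> 'e \<Rightarrow> 'e"
  of_alg :: "'b \<Rightarrow> 'e"

definition product_system :: "('b::unital_cstar, 'e::ab_group_add) psys \<Rightarrow> bool" where
  "product_system E \<longleftrightarrow>
     (\<forall>t\<ge>0. correspondence (fib E t)) \<and>
     (\<forall>s\<ge>0. \<forall>t\<ge>0. \<exists>u. bilinear_unitary (tensor (fib E s) (fib E t)) (fib E (s + t)) u \<and>
        (\<forall>x\<in>car (fib E s). \<forall>y\<in>car (fib E t).
           mul E s t x y = u (elem_tensor (fib E s) (fib E t) x y))) \<and>
     (\<forall>r\<ge>0. \<forall>s\<ge>0. \<forall>t\<ge>0. \<forall>x\<in>car (fib E r). \<forall>y\<in>car (fib E s). \<forall>z\<in>car (fib E t).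
        mul E (r + s) t (mul E r s x y) z = mul E r (s + t) x (mul E s t y z)) \<and>
     bilinear_unitary trivial_corr (fib E 0) (of_alg E) \<and>
     (\<forall>t\<ge>0. \<forall>x\<in>car (fib E t). \<forall>b.
        mul E 0 t (of_alg E b) x = lact (fib E t) b x \<and>
        mul E t 0 x (of_alg E b) = ract (fib E t) x b)"

definition embeds ::
  "('b::unital_cstar, 'e::ab_group_add) psys \<Rightarrow> ('b, 'g::ab_group_add) psys \<Rightarrow> bool" where
  "embeds E G \<longleftrightarrow> (\<exists>v :: real \<Rightarrow> 'e \<Rightarrow> 'g.
     (\<forall>t\<ge>0. bilinear_isometry (fib E t) (fib G t) (v t)) \<and>
     (\<forall>b. v 0 (of_alg E b) = of_alg G b) \<and>
     (\<forall>s\<ge>0. \<forall>t\<ge>0. \<forall>x\<in>car (fib E s). \<forall>y\<in>car (fib E t).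
        v (s + t) (mul E s t x y) = mul G s t (v s x) (v t y)))"

definition psys_unit :: "('b::unital_cstar, 'e) psys \<Rightarrow> (real \<Rightarrow> 'e) \<Rightarrow> bool" where
  "psys_unit E \<xi> \<longleftrightarrow>
     (\<forall>t\<ge>0. \<xi> t \<in> car (fib E t)) \<and> \<xi> 0 = of_alg E 1 \<and>
     (\<forall>s\<ge>0. \<forall>t\<ge>0. mul E s t (\<xi> s) (\<xi> t) = \<xi> (s + t))"

definition continuous_units :: "('b::unital_cstar, 'e) psys \<Rightarrow> (real \<Rightarrow> 'e) set \<Rightarrow> bool" where
  "continuous_units E S \<longleftrightarrow> (\<forall>\<xi>\<in>S. psys_unit E \<xi>) \<and>
     (\<forall>\<xi>\<in>S. \<forall>\<xi>'\<in>S. uniformly_cont (\<lambda>t b. ip (fib E t) (\<xi> t) (lact (fib E t) b (\<xi>' t))))"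

text \<open>\<open>word E S t\<close> holds of the elements
  \<open>b\<^sub>n \<xi>\<^sup>n\<^bsub>t\<^sub>n\<^esub> \<dots> b\<^sub>1 \<xi>\<^sup>1\<^bsub>t\<^sub>1\<^esub> b\<^sub>0\<close> with \<open>n \<ge> 1\<close>, \<open>t\<^sub>i > 0\<close> and
  \<open>t\<^sub>n + \<dots> + t\<^sub>1 = t\<close>.\<close>

inductive word :: "('b, 'e) psys \<Rightarrow> (real \<Rightarrow> 'e) set \<Rightarrow> real \<Rightarrow> 'e \<Rightarrow> bool" for E S where
  last: "t > 0 \<Longrightarrow> \<xi> \<in> S \<Longrightarrow> word E S t (ract (fib E t) (lact (fib E t) b (\<xi> t)) b\<^sub>0)"
| factor: "s > 0 \<Longrightarrow> \<xi> \<in> S \<Longrightarrow> word E S t x \<Longrightarrow>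
    word E S (s + t) (mul E s t (lact (fib E s) b (\<xi> s)) x)"

definition closed_span :: "('b::unital_cstar, 'e::ab_group_add) corr \<Rightarrow> 'e set \<Rightarrow> 'e set" where
  "closed_span E W = {y \<in> car E. \<forall>e>0. \<exists>(n::nat) (c :: nat \<Rightarrow> complex) w.
     (\<forall>i<n. w i \<in> W) \<and> mnorm E (y - (\<Sum>i<n. ract E (w i) (c i *\<^sub>C 1))) < e}"

definition generated_by ::
  "('b::unital_cstar, 'e::ab_group_add) psys \<Rightarrow> (real \<Rightarrow> 'e) set \<Rightarrow> bool" where
  "generated_by E S \<longleftrightarrow> (\<forall>t>0. closed_span (fib E t) {x. word E S t x} = car (fib E t))"

definition type_I :: "('b::unital_cstar, 'e::ab_group_add) psys \<Rightarrow> bool" where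
  "type_I E \<longleftrightarrow> (\<exists>S. continuous_units E S \<and> generated_by E S)"

text \<open>The GNS-system is unique only up to isomorphism, hence the predicate.\<close>

definition gns_system ::
  "(real \<Rightarrow> 'b \<Rightarrow> 'b) \<Rightarrow> ('b::unital_cstar, 'e::ab_group_add) psys \<Rightarrow> (real \<Rightarrow> 'e) \<Rightarrow> bool" where
  "gns_system T E \<xi> \<longleftrightarrow> product_system E \<and> psys_unit E \<xi> \<and>
     (\<forall>t\<ge>0. \<forall>b. T t b = ip (fib E t) (\<xi> t) (lact (fib E t) b (\<xi> t))) \<and>
     generated_by E {\<xi>}"

text \<open>The GNS-system of a semigroup of unital endomorphisms, with unit constantly \<open>1\<close>.\<close>

definition endo_system :: "(real \<Rightarrow> 'b \<Rightarrow> 'b) \<Rightarrow> ('b::unital_cstar, 'b) psys" where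
  "endo_system \<theta> = \<lparr>
     fib = (\<lambda>t. \<lparr>car = UNIV, ip = (\<lambda>x y. star x * y), lact = (\<lambda>b x. \<theta> t b * x), ract = (*)\<rparr>),
     mul = (\<lambda>s t x y. \<theta> t x * y),
     of_alg = (\<lambda>b. b)\<rparr>"

section \<open>Time ordered product systems\<close>

text \<open>Functions on \<open>[0, \<infinity>)\<close> are functions on \<^typ>\<open>real\<close> vanishing on the negative half-line.\<close>

definition step :: "real \<Rightarrow> real \<Rightarrow> 'f::ab_group_add \<Rightarrow> real \<Rightarrow> 'f" where
  "step a b x = (\<lambda>s. if a \<le> s \<and> s < b then x else 0)"

definition step_functions :: "('b, 'f::ab_group_add) corr \<Rightarrow> (real \<Rightarrow> 'f) set" where
  "step_functions F = {f. \<exists>l. (\<forall>(a, b, x)\<in>set l. 0 \<le> a \<and> a < b \<and> x \<in> car F) \<and>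
     f = (\<lambda>s. \<Sum>(a, b, x)\<leftarrow>l. step a b x s)}"

definition L2_kernel :: "('b::unital_cstar, 'f) corr \<Rightarrow> (real \<Rightarrow> 'f) \<Rightarrow> (real \<Rightarrow> 'f) \<Rightarrow> 'b" where
  "L2_kernel F f g = integral {0..} (\<lambda>s. ip F (f s) (g s))"

definition L2 :: "('b::unital_cstar, 'f::ab_group_add) corr \<Rightarrow> ('b, (real \<Rightarrow> 'f) \<Rightarrow> 'b) corr" where
  "L2 F = kernel_module (step_functions F) (L2_kernel F)
     (\<lambda>b \<phi> f. \<phi> (\<lambda>s. lact F (star b) (f s)))"

type_synonym ('b, 'f) fock = "nat \<Rightarrow> ((real \<Rightarrow> 'f) \<Rightarrow> 'b) list \<Rightarrow> 'b"

definition sector ::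
  "('b::unital_cstar, 'f::ab_group_add) corr \<Rightarrow> nat \<Rightarrow> ('b, ((real \<Rightarrow> 'f) \<Rightarrow> 'b) list \<Rightarrow> 'b) corr" where
  "sector F n = tensor_power (L2 F) n"

definition fock_module ::
  "('b::unital_cstar, 'f::ab_group_add) corr \<Rightarrow> ('b, ('b, 'f) fock) corr" where
  "fock_module F = \<lparr>
     car = {x. (\<forall>n. x n \<in> car (sector F n)) \<and> summable (\<lambda>n. ip (sector F n) (x n) (x n))},
     ip = (\<lambda>x y. \<Sum>n. ip (sector F n) (x n) (y n)),
     lact = (\<lambda>b x n. lact (sector F n) b (x n)),
     ract = (\<lambda>x b n. ract (sector F n) (x n) b)\<rparr>"

text \<open>Elements of the \<open>n\<close>-particle sector are viewed as functions of \<open>n\<close> time arguments, listed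
  as \<open>[t\<^sub>n, \<dots>, t\<^sub>1]\<close>. A list \<open>[(a\<^sub>n, b\<^sub>n), \<dots>, (a\<^sub>1, b\<^sub>1)]\<close> denotes the box
  \<open>[a\<^sub>n, b\<^sub>n) \<times> \<dots> \<times> [a\<^sub>1, b\<^sub>1)\<close>; the step function with value \<open>x\<^sub>n \<odot> \<dots> \<odot> x\<^sub>1\<close> on
  it is the elementary tensor of the one-variable step functions. An element vanishes on a set \<open>A\<close> of
  times if it is orthogonal to all step functions on boxes contained in \<open>A\<close>. (Up to null sets, every set \<open>A\<close>
  used below is a countable union of boxes, and so is its complement.)\<close>

definition box_points :: "(real \<times> real) list \<Rightarrow> real list set" where
  "box_points Q = {ts. list_all2 (\<lambda>t (a, b). a \<le> t \<and> t < b) ts Q}"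

definition box_tensor ::
  "('b::unital_cstar, 'f::ab_group_add) corr \<Rightarrow> (real \<times> real) list \<Rightarrow> 'f list \<Rightarrow>
    ((real \<Rightarrow> 'f) \<Rightarrow> 'b) list" where
  "box_tensor F Q xs =
     map2 (\<lambda>(a, b) x. class_of (step_functions F) (L2_kernel F) (step a b x)) Q xs"

definition vanishes_on ::
  "('b::unital_cstar, 'f::ab_group_add) corr \<Rightarrow> nat \<Rightarrow> real list set \<Rightarrow>
    (((real \<Rightarrow> 'f) \<Rightarrow> 'b) list \<Rightarrow> 'b) \<Rightarrow> bool" where
  "vanishes_on F n A \<phi> \<longleftrightarrow> (\<forall>Q xs.
     length Q = n \<and> (\<forall>(a, b)\<in>set Q. 0 \<le> a \<and> a < b) \<and> box_points Q \<subseteq> A \<and>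
     length xs = n \<and> set xs \<subseteq> car F \<longrightarrow> \<phi> (box_tensor F Q xs) = 0)"

text \<open>\<open>\<psi>\<close> is the product of \<open>\<phi>\<close> with the indicator function of \<open>A\<close>.\<close>

definition indicator_mult ::
  "('b::unital_cstar, 'f::ab_group_add) corr \<Rightarrow> nat \<Rightarrow> real list set \<Rightarrow>
    (((real \<Rightarrow> 'f) \<Rightarrow> 'b) list \<Rightarrow> 'b) \<Rightarrow> (((real \<Rightarrow> 'f) \<Rightarrow> 'b) list \<Rightarrow> 'b) \<Rightarrow> bool" where
  "indicator_mult F n A \<phi> \<psi> \<longleftrightarrow> vanishes_on F n (- A) \<psi> \<and> vanishes_on F n A (\<psi> - \<phi>)"

definition time_ordered :: "nat \<Rightarrow> real list set" where
  "time_ordered n = {ts. length ts = n \<and> sorted_wrt (>) ts \<and> (\<forall>t\<in>set ts. 0 \<le> t)}"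

definition Gamma :: "('b::unital_cstar, 'f::ab_group_add) corr \<Rightarrow> ('b, ('b, 'f) fock) corr" where
  "Gamma F = fock_module F \<lparr>car := {y \<in> car (fock_module F).
     \<exists>x\<in>car (fock_module F). \<forall>n. indicator_mult F n (time_ordered n) (x n) (y n)}\<rparr>"

definition Gamma_at ::
  "('b::unital_cstar, 'f::ab_group_add) corr \<Rightarrow> real \<Rightarrow> ('b, ('b, 'f) fock) corr" where
  "Gamma_at F t = fock_module F \<lparr>car := {x \<in> car (Gamma F).
     \<forall>n. vanishes_on F n {ts. ts \<noteq> [] \<and> t \<le> hd ts} (x n)}\<rparr>"

text \<open>The adjoint of the right shift by \<open>t\<close>, in terms of the representing functions.\<close>

definition shift_adj ::
  "('b::unital_cstar, 'f::ab_group_add) corr \<Rightarrow> real \<Rightarrow> ((real \<Rightarrow> 'f) \<Rightarrow> 'b) \<Rightarrow> (real \<Rightarrow> 'f) \<Rightarrow> 'b" where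
  "shift_adj F t w = (\<lambda>g. if g \<in> step_functions F then w (\<lambda>s. g (s - t)) else 0)"

text \<open>\<open>shifted_tensor F t m n \<phi> \<psi>\<close> is the function
  \<open>\<phi>(s\<^sub>m - t, \<dots>, s\<^sub>1 - t) \<odot> \<psi>(t\<^sub>n, \<dots>, t\<^sub>1)\<close>, that is, the tensor product of \<open>\<psi>\<close> with the right shift
  of \<open>\<phi>\<close>. Its inner product with \<open>x \<odot> y\<close> is \<open>\<langle>y, \<langle>x, \<phi>'\<rangle> \<psi>\<rangle>\<close>, where \<open>\<phi>'\<close> is the shift of \<open>\<phi>\<close>.\<close>

definition shifted_tensor ::
  "('b::unital_cstar, 'f::ab_group_add) corr \<Rightarrow> real \<Rightarrow> nat \<Rightarrow> nat \<Rightarrow>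
    (((real \<Rightarrow> 'f) \<Rightarrow> 'b) list \<Rightarrow> 'b) \<Rightarrow> (((real \<Rightarrow> 'f) \<Rightarrow> 'b) list \<Rightarrow> 'b) \<Rightarrow>
    ((real \<Rightarrow> 'f) \<Rightarrow> 'b) list \<Rightarrow> 'b" where
  "shifted_tensor F t m n \<phi> \<psi> = (\<lambda>fs.
     if length fs = m + n \<and> set fs \<subseteq> car (L2 F)
     then lact (sector F n) (\<phi> (map (shift_adj F t) (take m fs))) \<psi> (drop m fs)
     else 0)"

definition time_ordered_system ::
  "('b::unital_cstar, 'f::ab_group_add) corr \<Rightarrow> ('b, ('b, 'f) fock) psys" where
  "time_ordered_system F = \<lparr>
     fib = Gamma_at F,
     mul = (\<lambda>s t x y n. \<Sum>m\<le>n. shifted_tensor F t m (n - m) (x m) (y (n - m))),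
     of_alg = (\<lambda>b n fs. if n = 0 \<and> fs = [] then b else 0)\<rparr>"

end

theory Submission
  imports Defs
begin

text \<open>Let \<open>u\<^sub>t = e\<^bsup>-ith\<^esup>\<close>. Both spatiality and an embedding into a time ordered system produce a
  semigroup \<open>c\<close> in the algebra, not identically \<open>0\<close> for \<open>t > 0\<close>, with every \<open>c\<^sub>t\<close> a scalar multiple
  of \<open>u\<^sub>t\<close>: in the first case because \<open>c\<^sub>t\<close> is dominated by \<open>u\<^sub>t\<close> on rank one operators, in the second
  because the vacuum component \<open>c\<^sub>t\<close> of the image of the unit satisfies \<open>b c\<^sub>t = c\<^sub>t \<theta>\<^sub>t(b)\<close>, so that
  \<open>c\<^sub>t u\<^sub>t\<^sup>*\<close> commutes with all compact operators. Then \<open>u\<^sub>t\<close> lies in the algebra for all small \<open>t\<close>, and so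
  does its derivative at \<open>0\<close>, hence \<open>h\<close>.\<close>

section \<open>Star and exponential in a \<open>C\<^sup>*\<close>-algebra\<close>

lemma norm_star: "norm (star x) = norm (x::'a::unital_cstar)"
proof -
  have le: "norm y \<le> norm (star y)" for y :: 'a
  proof (cases "y = 0")
    case False
    have "norm y * norm y \<le> norm (star y) * norm y"
      using norm_mult_ineq[of "star y" y] by (simp add: cstar_identity power2_eq_square)
    then show ?thesis using False by simp
  qed simp
  show ?thesis using le[of x] le[of "star x"] by (simp add: star_star)
qed

lemma star_scaleR: "star (r *\<^sub>R x) = r *\<^sub>R star (x::'a::unital_cstar)"
  by (simp add: star_scaleC flip: scaleC_of_real)

text \<open>Real linearity is all that holds, \<open>star\<close> being conjugate linear. It
  suffices to carry \<open>star\<close> through sums, limits and the exponential series.\<close>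

lemma bounded_linear_star: "bounded_linear (star :: 'a::unital_cstar \<Rightarrow> 'a)"
  by (rule bounded_linear_intro[where K=1]) (auto simp: star_add star_scaleR norm_star)

lemma star_diff: "star (x - y) = star x - star (y::'a::unital_cstar)"
  by (rule linear_diff[OF bounded_linear.linear[OF bounded_linear_star]])

lemma star_zero: "star (0::'a::unital_cstar) = 0"
  using star_diff[of "0::'a" 0] by simp

lemma star_sum: "star (sum f A) = (\<Sum>i\<in>A. star (f i :: 'a::unital_cstar))"
  by (rule linear_sum[OF bounded_linear.linear[OF bounded_linear_star]])

lemma star_power: "star (x ^ n) = star (x::'a::unital_cstar) ^ n"
  by (induction n) (simp_all add: star_one star_mult power_commutes)

lemma star_exp: "star (exp x) = exp (star (x::'a::unital_cstar))"
  unfolding exp_def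
  by (simp add: bounded_linear.suminf[OF bounded_linear_star summable_exp_generic]
      star_scaleR star_power)

section \<open>Semigroups of unital endomorphisms\<close>

text \<open>The algebraic properties behind the GNS-system and the vacuum argument. Continuity in t
  does not enter here.\<close>

locale star_endomorphism_semigroup =
  fixes \<theta> :: "real \<Rightarrow> 'b::unital_cstar \<Rightarrow> 'b"
  assumes endo_add: "t \<ge> 0 \<Longrightarrow> \<theta> t (a + b) = \<theta> t a + \<theta> t b"
    and endo_scaleC: "t \<ge> 0 \<Longrightarrow> \<theta> t (z *\<^sub>C a) = z *\<^sub>C \<theta> t a"
    and endo_mult: "t \<ge> 0 \<Longrightarrow> \<theta> t (a * b) = \<theta> t a * \<theta> t b"
    and endo_star: "t \<ge> 0 \<Longrightarrow> \<theta> t (star a) = star (\<theta> t a)"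
    and endo_one: "t \<ge> 0 \<Longrightarrow> \<theta> t 1 = 1"
    and endo_0: "\<theta> 0 a = a"
    and endo_semigroup: "s \<ge> 0 \<Longrightarrow> t \<ge> 0 \<Longrightarrow> \<theta> (s + t) a = \<theta> s (\<theta> t a)"
begin

lemma endo_zero: "t \<ge> 0 \<Longrightarrow> \<theta> t 0 = 0"
  using endo_add[of t 0 0] by simp

text \<open>The product \<open>\<theta> t x * y\<close> applies \<theta>_t to what already lies in
  the fibre at s, so this order of composition appears in the product system.\<close>

lemma endo_semigroup': "s \<ge> 0 \<Longrightarrow> t \<ge> 0 \<Longrightarrow> \<theta> (s + t) a = \<theta> t (\<theta> s a)"
  using endo_semigroup[of t s a] by (simp add: add.commute)

lemma endo_sum: "t \<ge> 0 \<Longrightarrow> \<theta> t (sum f A) = (\<Sum>i\<in>A. \<theta> t (f i))"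
  by (induction A rule: infinite_finite_induct) (simp_all add: endo_zero endo_add)

lemma completely_positive_endo:
  assumes "t \<ge> 0" shows "completely_positive (\<theta> t)"
  unfolding completely_positive_def
proof (intro conjI allI)
  fix n and X :: "nat \<Rightarrow> nat \<Rightarrow> 'b"
  show "\<exists>Y. \<forall>i<n. \<forall>j<n. \<theta> t (\<Sum>k<n. star (X k i) * X k j) = (\<Sum>k<n. star (Y k i) * Y k j)"
    \<comment> \<open>Entrywise application is a *-homomorphism of matrices, so X^*X goes to
      \<theta>(X)^*\<theta>(X).\<close>
    by (rule exI[of _ "\<lambda>k i. \<theta> t (X k i)"])
      (simp add: endo_sum endo_mult endo_star assms)
qed (simp_all add: endo_add endo_scaleC assms)

lemma markov: "markov_semigroup \<theta>"
  unfolding markov_semigroup_def cp_semigroup_def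
  by (simp add: completely_positive_endo endo_0 endo_semigroup endo_one)

end

section \<open>The product system of an endomorphism semigroup\<close>

definition support_sum :: "('s \<Rightarrow> 'b) \<Rightarrow> ('s \<Rightarrow> 'b) \<Rightarrow> 'b::unital_cstar" where
  "support_sum f c = (\<Sum>r | c r \<noteq> 0. f r * c r)"

lemma support_sum_superset:
  assumes "finite A" "{r. c r \<noteq> 0} \<subseteq> A"
  shows "support_sum f c = (\<Sum>r\<in>A. f r * c r)"
  unfolding support_sum_def by (rule sum.mono_neutral_left) (use assms in auto)

lemma support_sum_diff:
  assumes "finite {r. c r \<noteq> 0}" "finite {r. d r \<noteq> 0}"
  shows "support_sum f (c - d) = support_sum f c - support_sum f d"
proof -
  \<comment> \<open>Cancellation may shrink the support of \<open>c - d\<close>, so all three sums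
    are taken over the union of the two supports.\<close>
  let ?A = "{r. c r \<noteq> 0} \<union> {r. d r \<noteq> 0}"
  have "support_sum f (c - d) = (\<Sum>r\<in>?A. f r * (c - d) r)"
    by (rule support_sum_superset) (use assms in auto)
  also have "\<dots> = (\<Sum>r\<in>?A. f r * c r) - (\<Sum>r\<in>?A. f r * d r)"
    by (simp add: right_diff_distrib sum_subtractf)
  also have "\<dots> = support_sum f c - support_sum f d"
    using support_sum_superset[of ?A c f] support_sum_superset[of ?A d f] assms by simp
  finally show ?thesis .
qed

text \<open>The inner product of the algebra as a module over itself, pulled back along
  \<open>f\<close>; formal sums are mapped into the algebra by \<open>support_sum f\<close>.\<close>

definition gram_kernel :: "('s \<Rightarrow> 'b) \<Rightarrow> 's \<Rightarrow> 's \<Rightarrow> 'b::unital_cstar" where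
  "gram_kernel f r s = star (f r) * f s"

lemma kernel_ip_gram:
  "kernel_ip (gram_kernel f) c d = star (support_sum f c) * support_sum f d"
  unfolding kernel_ip_def gram_kernel_def support_sum_def star_sum sum_product
  by (simp add: star_mult mult.assoc)

text \<open>By the C^*-identity, \<open>support_sum f\<close> turns Cauchy sequences of formal sums
  into Cauchy sequences of the algebra. Their limit \<open>w\<close> is the element
  represented.\<close>

lemma represents_gram:
  assumes "represents UNIV (gram_kernel f) c \<phi>"
  obtains w where "(\<lambda>n. support_sum f (c n)) \<longlonglongrightarrow> w" "\<phi> = (\<lambda>s. star (f s) * w)"
proof -
  let ?W = "\<lambda>n. support_sum f (c n)"
  have fin: "finite {r. c n r \<noteq> 0}" for n
    using assms unfolding represents_def formal_sums_def by blast
  have "Cauchy ?W"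
  proof (rule metric_CauchyI)
    fix e :: real assume "e > 0"
    then have "e\<^sup>2 > 0" by simp
    then obtain N where N: "\<And>m n. m \<ge> N \<Longrightarrow> n \<ge> N \<Longrightarrow>
        norm (kernel_ip (gram_kernel f) (c m - c n) (c m - c n)) < e\<^sup>2"
      using assms unfolding represents_def by meson
    have "dist (?W m) (?W n) < e" if "m \<ge> N" "n \<ge> N" for m n
      using N[OF that] \<open>e > 0\<close>
      by (simp add: kernel_ip_gram cstar_identity support_sum_diff fin dist_norm
          power_less_imp_less_base)
    then show "\<exists>M. \<forall>m\<ge>M. \<forall>n\<ge>M. dist (?W m) (?W n) < e" by blast
  qed
  then obtain w where w: "?W \<longlonglongrightarrow> w" by (meson Cauchy_convergent convergentD)
  have "\<phi> s = star (f s) * w" for s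
  proof (rule LIMSEQ_unique)
    have "(\<lambda>n. \<Sum>r | c n r \<noteq> 0. gram_kernel f s r * c n r) \<longlonglongrightarrow> \<phi> s"
      using assms unfolding represents_def by blast
    moreover have "(\<Sum>r | c n r \<noteq> 0. gram_kernel f s r * c n r) = star (f s) * ?W n" for n
      by (simp add: gram_kernel_def support_sum_def sum_distrib_left mult.assoc)
    ultimately show "(\<lambda>n. star (f s) * ?W n) \<longlonglongrightarrow> \<phi> s" by simp
    show "(\<lambda>n. star (f s) * ?W n) \<longlonglongrightarrow> star (f s) * w" by (intro tendsto_intros w)
  qed
  with w that show ?thesis by blast
qed

lemma represents_gram_const:
  fixes f :: "'s \<Rightarrow> 'b::unital_cstar"
  shows "represents UNIV (gram_kernel f) (\<lambda>n r. if r = r0 then 1 else 0) (\<lambda>s. star (f s) * f r0)"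
proof -
  have [simp]: "{r. (if r = r0 then 1 else 0) \<noteq> (0::'b)} = {r0}" by auto
  show ?thesis
    unfolding represents_def formal_sums_def by (simp add: gram_kernel_def kernel_ip_def)
qed

text \<open>If \<open>f\<close> is onto, every \<open>w\<close> is the image of a single generator,
  represented by a constant sequence. So the completion is a copy of the algebra.\<close>

lemma car_gram_module:
  assumes "surj f"
  shows "car (kernel_module UNIV (gram_kernel f) L) = range (\<lambda>z s. star (f s) * z)"
proof (intro set_eqI iffI)
  fix \<phi> assume "\<phi> \<in> car (kernel_module UNIV (gram_kernel f) L)"
  then show "\<phi> \<in> range (\<lambda>z s. star (f s) * z)"
    unfolding kernel_module_def by (auto elim!: represents_gram)
next
  fix \<phi> assume "\<phi> \<in> range (\<lambda>z s. star (f s) * z)"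
  then obtain r0 where "\<phi> = (\<lambda>s. star (f s) * f r0)" using assms by (metis rangeE surjE)
  then show "\<phi> \<in> car (kernel_module UNIV (gram_kernel f) L)"
    unfolding kernel_module_def using represents_gram_const[of f r0] by auto
qed

text \<open>\<open>ip\<close> is computed from an arbitrarily chosen representing sequence. Its
  limit is nevertheless \<open>w\<close>: compare the represented functions at a point where
  \<open>f\<close> is 1.\<close>

lemma ip_gram_module:
  assumes "surj f"
  shows "ip (kernel_module UNIV (gram_kernel f) L) (\<lambda>s. star (f s) * w) (\<lambda>s. star (f s) * z) =
    star w * z"
proof -
  define c where "c = (SOME c. represents UNIV (gram_kernel f) c (\<lambda>s. star (f s) * w))"
  obtain r0 where "w = f r0" using assms by (metis surjD)
  then have "represents UNIV (gram_kernel f) c (\<lambda>s. star (f s) * w)"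
    unfolding c_def using represents_gram_const[of f r0] by (metis someI)
  then obtain w' where lim: "(\<lambda>n. support_sum f (c n)) \<longlonglongrightarrow> w'"
    and w': "(\<lambda>s. star (f s) * w) = (\<lambda>s. star (f s) * w')"
    by (rule represents_gram)
  obtain e where "f e = 1" using assms by (metis surjD)
  with fun_cong[OF w', of e] have "w' = w" by (simp add: star_one)
  have "(\<lambda>n. star (support_sum f (c n)) * z) \<longlonglongrightarrow> star w * z"
    by (intro tendsto_intros bounded_linear.tendsto[OF bounded_linear_star]
        lim[unfolded \<open>w' = w\<close>])
  then have "lim (\<lambda>n. star (support_sum f (c n)) * z) = star w * z" by (rule limI)
  moreover have "(\<Sum>s | c n s \<noteq> 0. star (c n s) * (star (f s) * z)) = star (support_sum f (c n)) * z" for n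
    by (simp add: support_sum_def star_sum star_mult sum_distrib_right mult.assoc)
  ultimately show ?thesis
    unfolding kernel_module_def by (simp add: c_def[symmetric])
qed

section \<open>Tensor products of the fibres and the GNS property\<close>

context star_endomorphism_semigroup
begin

abbreviation E_fib :: "real \<Rightarrow> ('b, 'b) corr" where
  "E_fib t \<equiv> fib (endo_system \<theta>) t"

lemma endo_system_simps [simp]:
  "car (E_fib t) = UNIV" "ip (E_fib t) x y = star x * y"
  "lact (E_fib t) b x = \<theta> t b * x" "ract (E_fib t) x b = x * b"
  "mul (endo_system \<theta>) s t x y = \<theta> t x * y" "of_alg (endo_system \<theta>) b = b"
  by (simp_all add: endo_system_def)

lemma mnorm_fib: "mnorm (E_fib t) x = norm x"
  by (simp add: mnorm_def cstar_identity)

lemma correspondence_fib: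
  assumes t: "t \<ge> 0" shows "correspondence (E_fib t)"
proof -
  have z: "x = 0" if "star x * x = 0" for x :: 'b
    using cstar_identity[of x] that by simp
  have c: "\<exists>x. (\<lambda>n. norm (X n - x)) \<longlonglongrightarrow> 0"
    if "\<forall>e>0. \<exists>N. \<forall>m\<ge>N. \<forall>n\<ge>N. norm (X m - X n) < e" for X :: "nat \<Rightarrow> 'b"
  proof -
    have "Cauchy X" using that by (simp add: Cauchy_def dist_norm)
    then obtain x where "X \<longlonglongrightarrow> x" by (meson Cauchy_convergent convergentD)
    then show ?thesis using tendsto_norm_zero Lim_null by blast
  qed
  show ?thesis
    unfolding correspondence_def hilbert_module_def mnorm_fib
  proof (intro conjI ballI allI impI)
    fix X :: "nat \<Rightarrow> 'b"
    assume "(\<forall>n. X n \<in> car (E_fib t)) \<and>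
      (\<forall>e>0. \<exists>N. \<forall>m\<ge>N. \<forall>n\<ge>N. norm (X m - X n) < e)"
    then show "\<exists>x\<in>car (E_fib t). (\<lambda>n. norm (X n - x)) \<longlonglongrightarrow> 0" using c[of X] by simp
  next
    show "positive (ip (E_fib t) x x)" for x unfolding positive_def by auto
    show "x = 0" if "ip (E_fib t) x x = 0" for x using that z[of x] by simp
  qed (simp_all add: t distrib_left distrib_right mult.assoc endo_add endo_scaleC endo_mult
      endo_one star_mult star_star mult_scaleC_left mult_scaleC_right endo_star)
qed

text \<open>The tensor kernel is the Gram kernel of (x, y) \<mapsto> \<theta>_t(x) y, which is onto
  because (1, y) goes to y. Since it takes the value 1 at (1, 1), evaluation there recovers the
  algebra element from its representing function.\<close>

lemma tensor_fib:
  assumes "s \<ge> 0" "t \<ge> 0"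
  shows "bilinear_unitary (tensor (E_fib s) (E_fib t)) (E_fib (s + t)) (\<lambda>\<phi>. \<phi> (1, 1))"
    and "elem_tensor (E_fib s) (E_fib t) x y (1, 1) = \<theta> t x * y"
proof -
  define f where "f = (\<lambda>(x, y). \<theta> t x * y)"
  have f: "f (x, y) = \<theta> t x * y" for x y by (simp add: f_def)
  have K: "tensor_kernel (E_fib s) (E_fib t) = gram_kernel f"
    by (auto simp: tensor_kernel_def gram_kernel_def f_def fun_eq_iff endo_mult endo_star
        star_mult assms mult.assoc)
  have surj: "surj f"
    by (rule surjI[of _ "\<lambda>y. (1, y)"]) (simp add: f endo_one assms)
  have f1: "f (1, 1) = 1" by (simp add: f endo_one assms)
  define L :: "'b \<Rightarrow> ('b \<times> 'b \<Rightarrow> 'b) \<Rightarrow> 'b \<times> 'b \<Rightarrow> 'b"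
    where "L = (\<lambda>b \<phi> (x, y). \<phi> (\<theta> s (star b) * x, y))"
  have M: "tensor (E_fib s) (E_fib t) = kernel_module UNIV (gram_kernel f) L"
    by (simp add: tensor_def K L_def)
  \<comment> \<open>The left action of b on the first factor is multiplication by \<theta>_s(b),
    which the map \<open>f\<close> turns into multiplication by \<theta>_t(\<theta>_s(b)).\<close>
  have lact: "lact (kernel_module UNIV (gram_kernel f) L) b (\<lambda>s. star (f s) * z) (1, 1) = \<theta> (s + t) b * z"
    for b z
    by (simp add: kernel_module_def L_def f endo_star endo_mult endo_one star_star
        endo_semigroup' assms)
  show "bilinear_unitary (tensor (E_fib s) (E_fib t)) (E_fib (s + t)) (\<lambda>\<phi>. \<phi> (1, 1))"
    unfolding bilinear_unitary_def bilinear_isometry_def M car_gram_module[OF surj]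
  proof (intro conjI ballI allI)
    show "(\<lambda>\<phi>. \<phi> (1, 1)) ` range (\<lambda>z s. star (f s) * z) = car (E_fib (s + t))"
      by (auto simp: image_image f1 star_one)
  qed (auto simp: ip_gram_module[OF surj] lact f1 star_one, auto simp: kernel_module_def f1 star_one)
  show "elem_tensor (E_fib s) (E_fib t) x y (1, 1) = \<theta> t x * y"
    unfolding elem_tensor_def class_of_def K gram_kernel_def f1 by (simp add: f star_one)
qed

lemma gns_endo_system: "gns_system \<theta> (endo_system \<theta>) (\<lambda>t. 1)"
proof -
  have "product_system (endo_system \<theta>)"
    unfolding product_system_def
  proof (intro conjI allI impI ballI)
    fix s t :: real assume st: "0 \<le> s" "0 \<le> t"
    show "\<exists>u. bilinear_unitary (tensor (E_fib s) (E_fib t)) (E_fib (s + t)) u \<and>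
        (\<forall>x\<in>car (E_fib s). \<forall>y\<in>car (E_fib t).
           mul (endo_system \<theta>) s t x y = u (elem_tensor (E_fib s) (E_fib t) x y))"
      using tensor_fib[OF st] by (intro exI[of _ "\<lambda>\<phi>. \<phi> (1, 1)"]) simp
  next
    show "bilinear_unitary trivial_corr (E_fib 0) (of_alg (endo_system \<theta>))"
      unfolding bilinear_unitary_def bilinear_isometry_def
      by (auto simp: trivial_corr_def endo_0)
  qed (simp_all add: correspondence_fib endo_mult endo_semigroup' endo_0 mult.assoc)
  moreover have "psys_unit (endo_system \<theta>) (\<lambda>t. 1)"
    by (simp add: psys_unit_def endo_one)
  moreover have "generated_by (endo_system \<theta>) {\<lambda>t. 1}"
    unfolding generated_by_def
  proof (intro allI impI)
    fix t :: real assume t: "t > 0"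
    \<comment> \<open>Words with a single factor, with left coefficient 1 and right coefficient y,
      already exhaust the fibre.\<close>
    have word: "word (endo_system \<theta>) {\<lambda>t. 1} t y" for y
      using word.last[OF t singletonI, of "endo_system \<theta>" "\<lambda>t. 1" 1 y] t by (simp add: endo_one)
    have "y \<in> closed_span (E_fib t) {x. word (endo_system \<theta>) {\<lambda>t. 1} t x}" for y
      unfolding closed_span_def using word
      by (auto intro!: exI[of _ "1::nat"] exI[of _ "\<lambda>_. 1"] exI[of _ "\<lambda>_. y"] simp: mnorm_fib)
    then show "closed_span (E_fib t) {x. word (endo_system \<theta>) {\<lambda>t. 1} t x} = car (E_fib t)"
      by auto
  qed
  ultimately show ?thesis by (simp add: gns_system_def star_one)
qed

end

section \<open>Embeddings into time ordered product systems\<close>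

lemma lact_sector_0: "lact (sector F 0) b \<phi> [] = b * \<phi> []"
  by (simp add: sector_def tensor_power_def kernel_module_def)

lemma lact_sector_zero: "lact (sector F n) b 0 = 0"
  by (auto simp: sector_def tensor_power_def kernel_module_def fun_eq_iff split: list.split)

text \<open>For n = 0 this leaves the empty list as the only argument to check.\<close>

lemma sector_outside:
  assumes "\<phi> \<in> car (sector F n)" "length fs \<noteq> n" shows "\<phi> fs = 0"
  using assms by (auto simp: sector_def tensor_power_def kernel_module_def represents_def)

lemma ip_sector_zero: "ip (sector F n) \<phi> 0 = 0"
  by (simp add: sector_def tensor_power_def kernel_module_def)

text \<open>The relation \<open>b \<xi>\<^sub>t = \<xi>\<^sub>t \<theta>\<^sub>t(b)\<close> holds as the difference has length zero, and it passes to the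
  image \<open>\<eta>\<close> of \<open>\<xi>\<close> and to its vacuum component \<open>c\<^sub>t\<close>. If \<open>c\<^sub>t\<close> were \<open>0\<close> for all \<open>t > 0\<close>, then by
  \<open>\<eta>\<^sub>t = \<eta>\<^bsub>t/2\<^esub> \<eta>\<^bsub>t/2\<^esub>\<close> one sector after the other would vanish on \<open>\<eta>\<close>.\<close>

lemma (in star_endomorphism_semigroup) vacuum_component:
  fixes E :: "('b, 'e::ab_group_add) psys" and F :: "('b, 'f::ab_group_add) corr"
  assumes gns: "gns_system \<theta> E \<xi>" and emb: "embeds E (time_ordered_system F)"
  obtains c :: "real \<Rightarrow> 'b" and t0 where
    "\<And>s t. s \<ge> 0 \<Longrightarrow> t \<ge> 0 \<Longrightarrow> c s * c t = c (s + t)"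
    "\<And>t b. t \<ge> 0 \<Longrightarrow> b * c t = c t * \<theta> t b"
    "t0 > 0" "c t0 \<noteq> 0"
proof -
  have corr: "correspondence (fib E t)" and \<xi>: "\<xi> t \<in> car (fib E t)"
    and T: "ip (fib E t) (\<xi> t) (lact (fib E t) b (\<xi> t)) = \<theta> t b"
    and \<xi>_mult: "s \<ge> 0 \<Longrightarrow> mul E s t (\<xi> s) (\<xi> t) = \<xi> (s + t)" if "t \<ge> 0" for s t b
    using gns that unfolding gns_system_def product_system_def psys_unit_def by metis+
  have comm: "lact (fib E t) b (\<xi> t) = ract (fib E t) (\<xi> t) (\<theta> t b)" if t: "t \<ge> 0" for t b
  proof -
    let ?E = "fib E t" and ?x = "\<xi> t"
    have hm: "hilbert_module ?E" using corr[OF t] unfolding correspondence_def by metis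
    note x = \<xi>[OF t]
    have lcar: "lact ?E b y \<in> car ?E" if "y \<in> car ?E" for y b
      using corr[OF t] that unfolding correspondence_def by metis
    have rcar: "ract ?E y b \<in> car ?E" if "y \<in> car ?E" for y b
      using hm that unfolding hilbert_module_def by metis
    have diff: "y - z \<in> car ?E" if "y \<in> car ?E" "z \<in> car ?E" for y z
      using hm that unfolding hilbert_module_def by metis
    have ip_add: "ip ?E z (y + y') = ip ?E z y + ip ?E z y'"
      if "y \<in> car ?E" "y' \<in> car ?E" "z \<in> car ?E" for y y' z
      using hm that unfolding hilbert_module_def by metis
    have ip_diff: "ip ?E z (y - y') = ip ?E z y - ip ?E z y'"
      if "y \<in> car ?E" "y' \<in> car ?E" "z \<in> car ?E" for y y' z
      using ip_add[OF diff[OF that(1,2)] that(2,3)] by (simp add: algebra_simps)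
    have ip_ract: "ip ?E z (ract ?E y c) = ip ?E z y * c" if "y \<in> car ?E" "z \<in> car ?E" for y z c
      using hm that unfolding hilbert_module_def by metis
    have ip_star: "ip ?E y z = star (ip ?E z y)" if "y \<in> car ?E" "z \<in> car ?E" for y z
      using hm that unfolding hilbert_module_def by metis
    have definite: "y = 0" if "y \<in> car ?E" "ip ?E y y = 0" for y
      using hm that unfolding hilbert_module_def by metis
    have adj: "ip ?E y (lact ?E c z) = ip ?E (lact ?E (star c) y) z"
      if "y \<in> car ?E" "z \<in> car ?E" for y z c
      using corr[OF t] that unfolding correspondence_def by metis
    have lmul: "lact ?E (a * c) y = lact ?E a (lact ?E c y)" if "y \<in> car ?E" for y a c
      using corr[OF t] that unfolding correspondence_def by metis
    have l1: "lact ?E 1 ?x = ?x" using corr[OF t] x unfolding correspondence_def by metis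
    have xx: "ip ?E ?x ?x = 1" using T[OF t, of 1] by (simp add: l1 endo_one t)
    let ?l = "lact ?E b ?x" and ?r = "ract ?E ?x (\<theta> t b)"
    have car: "?l \<in> car ?E" "?r \<in> car ?E" by (simp_all add: lcar rcar x)
    \<comment> \<open>All four inner products between \<open>?l\<close> and \<open>?r\<close> agree.
      Multiplicativity of \<theta>_t enters in \<open>ll\<close>, and the unit length of \<xi>_t in
      \<open>rr\<close>.\<close>
    have ll: "ip ?E ?l ?l = star (\<theta> t b) * \<theta> t b"
      using adj[OF x car(1), of "star b"] T[OF t, of "star b * b"]
      by (simp add: star_star lmul[OF x] endo_mult endo_star t)
    have lr: "ip ?E ?l ?r = star (\<theta> t b) * \<theta> t b"
      using ip_ract[OF x car(1)] ip_star[OF car(1) x] T[OF t, of b] by simp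
    have rl: "ip ?E ?r ?l = star (\<theta> t b) * \<theta> t b"
      using ip_star[OF car(2) car(1)] lr by (simp add: star_mult star_star)
    have rr: "ip ?E ?r ?r = star (\<theta> t b) * \<theta> t b"
      using ip_ract[OF x car(2)] ip_star[OF car(2) x] ip_ract[OF x x] by (simp add: xx)
    have d: "?l - ?r \<in> car ?E" by (rule diff[OF car])
    have "ip ?E (?l - ?r) ?l = 0" "ip ?E (?l - ?r) ?r = 0"
      using ip_star[OF d car(1)] ip_star[OF d car(2)]
        ip_diff[OF car car(1)] ip_diff[OF car car(2)] by (simp_all add: ll lr rl rr star_zero)
    then have "ip ?E (?l - ?r) (?l - ?r) = 0"
      using ip_diff[OF car d] by simp
    then show ?thesis using definite[OF d] by simp
  qed
  let ?G = "time_ordered_system F"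
  obtain v where v: "\<And>t. t \<ge> 0 \<Longrightarrow> bilinear_isometry (fib E t) (fib ?G t) (v t)"
    and v_mult: "\<And>s t x y. s \<ge> 0 \<Longrightarrow> t \<ge> 0 \<Longrightarrow> x \<in> car (fib E s) \<Longrightarrow> y \<in> car (fib E t) \<Longrightarrow>
        v (s + t) (mul E s t x y) = mul ?G s t (v s x) (v t y)"
    using emb unfolding embeds_def by metis
  define \<eta> where "\<eta> t = v t (\<xi> t)" for t
  have \<eta>_comm: "lact (sector F n) b (\<eta> t n) fs = \<eta> t n fs * \<theta> t b" if t: "t \<ge> 0" for t n b fs
  proof -
    have "lact (fib ?G t) b (\<eta> t) = ract (fib ?G t) (\<eta> t) (\<theta> t b)"
      using v[OF t] comm[OF t] \<xi>[OF t] unfolding bilinear_isometry_def \<eta>_def by metis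
    then have "(\<lambda>n. lact (sector F n) b (\<eta> t n)) = (\<lambda>n. ract (sector F n) (\<eta> t n) (\<theta> t b))"
      by (simp add: time_ordered_system_def Gamma_at_def Gamma_def fock_module_def)
    from fun_cong[OF this, of n] show ?thesis
      by (simp add: sector_def tensor_power_def kernel_module_def fun_eq_iff)
  qed
  have \<eta>_car: "\<eta> t n \<in> car (sector F n)" if t: "t \<ge> 0" for t n
    using v[OF t] \<xi>[OF t] unfolding bilinear_isometry_def \<eta>_def
    by (auto simp: time_ordered_system_def Gamma_at_def Gamma_def fock_module_def)
  have \<eta>_mult: "\<eta> (s + t) n = (\<Sum>m\<le>n. shifted_tensor F t m (n - m) (\<eta> s m) (\<eta> t (n - m)))"
    if "s \<ge> 0" "t \<ge> 0" for s t n
    using v_mult[OF that \<xi>[OF that(1)] \<xi>[OF that(2)]] \<xi>_mult[OF that(2,1)]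
    by (simp add: \<eta>_def time_ordered_system_def)
  \<comment> \<open>Isometry preserves the unit length of \<xi>_t; this forbids all sectors of
    \<eta>_t from vanishing.\<close>
  have \<eta>_norm: "(\<Sum>n. ip (sector F n) (\<eta> t n) (\<eta> t n)) = 1" if t: "t \<ge> 0" for t
  proof -
    have "lact (fib E t) 1 (\<xi> t) = \<xi> t"
      using \<xi>[OF t] corr[OF t] unfolding correspondence_def by metis
    then have "ip (fib ?G t) (\<eta> t) (\<eta> t) = ip (fib E t) (\<xi> t) (lact (fib E t) 1 (\<xi> t))"
      using v[OF t] \<xi>[OF t] unfolding bilinear_isometry_def \<eta>_def by simp
    also have "\<dots> = 1" by (simp add: T t endo_one)
    finally show ?thesis by (simp add: time_ordered_system_def Gamma_at_def Gamma_def fock_module_def)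
  qed
  define c where "c t = \<eta> t 0 []" for t
  \<comment> \<open>In sector 0 the sum over m has the single term m = 0, where the action is
    multiplication in the algebra.\<close>
  have "c s * c t = c (s + t)" if "s \<ge> 0" "t \<ge> 0" for s t
    using \<eta>_mult[OF that, of 0] by (simp add: c_def shifted_tensor_def lact_sector_0)
  moreover have "b * c t = c t * \<theta> t b" if "t \<ge> 0" for t b
    using \<eta>_comm[OF that, of 0 b "[]"] by (simp add: c_def lact_sector_0)
  moreover have "\<exists>t>0. c t \<noteq> 0"
  proof (rule ccontr)
    assume no: "\<not> (\<exists>t>0. c t \<noteq> 0)"
    have "\<eta> t n = 0" if "t > 0" for t n
      using that
    proof (induction n arbitrary: t rule: less_induct)
      case (less n)
      define s where "s = t / 2"
      have s: "s > 0" "t = s + s" using less.prems by (simp_all add: s_def)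
      show ?case
      proof (cases "n = 0")
        case True
        have "\<eta> t 0 fs = 0" for fs
          using no less.prems sector_outside[OF \<eta>_car[of t 0], of fs] by (cases fs) (auto simp: c_def)
        then show ?thesis using True by (simp add: fun_eq_iff)
      next
        case False
        \<comment> \<open>For m > 0 the right factor lies in a lower sector. For m = 0 it is
          \<eta>_s in sector n itself, and the vacuum component on the left must supply the
          zero.\<close>
        have "shifted_tensor F s m (n - m) (\<eta> s m) (\<eta> s (n - m)) = 0" if m: "m \<le> n" for m
        proof (cases "m = 0")
          case True
          have "\<eta> s 0 = 0" by (rule less.IH) (use False s in simp_all)
          \<comment> \<open>This is the commutation relation at b = 0, as \<theta>_s(0) = 0.\<close>
          moreover have "lact (sector F n) 0 (\<eta> s n) = 0"
            using \<eta>_comm[of s n 0] s by (simp add: fun_eq_iff endo_zero)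
          ultimately show ?thesis using True by (intro ext) (simp add: shifted_tensor_def)
        next
          case False
          then have "\<eta> s (n - m) = 0" by (intro less.IH) (use m s in simp_all)
          then show ?thesis by (intro ext) (simp add: shifted_tensor_def lact_sector_zero)
        qed
        then show ?thesis using \<eta>_mult[of s s n] s by simp
      qed
    qed
    then show False using \<eta>_norm[of 1] by (simp add: ip_sector_zero)
  qed
  ultimately show ?thesis using that by blast
qed

section \<open>Rank one operators\<close>

lemma cinner_zero_left: "cinner (0::'h::chilbert_space) x = 0"
  using cinner_diff_left[of "0::'h" 0 x] by simp

lemma cinner_zero_right: "cinner x (0::'h::chilbert_space) = 0"
  using cinner_diff_right[of x "0::'h" 0] by simp

lemma bounded_linear_rank_one: "bounded_linear (\<lambda>y. cinner x y *\<^sub>C (x::'h::chilbert_space))"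
proof (rule bounded_linear_intro[where K="norm x * norm x"])
  show "cinner x (r *\<^sub>R y) *\<^sub>C x = r *\<^sub>R (cinner x y *\<^sub>C x)" for r y
    by (simp add: cinner_scaleC_right scaleC_scaleC flip: scaleC_of_real)
  show "norm (cinner x y *\<^sub>C x) \<le> norm y * (norm x * norm x)" for y
    using mult_right_mono[OF norm_cinner_le[of x y], of "norm x"]
    by (simp add: norm_scaleC mult_ac)
qed (simp add: cinner_add_right scaleC_add_left)

text \<open>The square of the norm of \<open>x\<close> times the projection onto the line of
  \<open>x\<close>. These are the test elements of the algebra: for nonzero \<open>x\<close> the
  kernel is the orthogonal complement of \<open>x\<close>.\<close>

lift_definition rank_one :: "'h::chilbert_space \<Rightarrow> 'h bop" is
  "\<lambda>x. Blinfun (\<lambda>y. cinner x y *\<^sub>C x)"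
  by (simp add: bounded_linear_Blinfun_apply bounded_linear_rank_one cinner_scaleC_right
      scaleC_scaleC)

lemma rank_one_apply: "bop_apply (rank_one x) y = cinner x y *\<^sub>C x"
  by transfer (simp add: bounded_linear_Blinfun_apply bounded_linear_rank_one)

text \<open>The unit ball is mapped into the multiples of \<open>x\<close> by scalars from a closed
  disc, a compact set.\<close>

lemma compact_op_rank_one: "compact_op (rank_one x)"
proof -
  let ?D = "(\<lambda>a. a *\<^sub>C x) ` cball 0 (norm x)"
  have "compact ?D"
    by (intro compact_continuous_image linear_continuous_on bounded_linear_scaleC_left) simp
  moreover have "bop_apply (rank_one x) ` ball 0 1 \<subseteq> ?D"
  proof (clarsimp simp: rank_one_apply)
    fix y :: 'a assume "norm y < 1"
    then have "cmod (cinner x y) \<le> norm x"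
      using norm_cinner_le[of x y] mult_left_mono[of "norm y" 1 "norm x"] by simp
    then show "cinner x y *\<^sub>C x \<in> ?D" by simp
  qed
  ultimately have "closure (bop_apply (rank_one x) ` ball 0 1) \<subseteq> ?D"
    by (simp add: closure_minimal compact_imp_closed)
  then show ?thesis
    unfolding compact_op_def
    using \<open>compact ?D\<close> by (metis closed_closure compact_Int_closed inf.absorb_iff2 inf_commute)
qed

lemma in_range_of_uc: "A \<in> range of_uc \<longleftrightarrow> (\<exists>K c. compact_op K \<and> A = K + c *\<^sub>C 1)"
  unfolding type_definition.Rep_range[OF type_definition_unitized_compacts] by (rule mem_Collect_eq)

lemma rank_one_in_range: "rank_one x \<in> range of_uc"
  unfolding in_range_of_uc
  by (intro exI[of _ "rank_one x"] exI[of _ 0]) (simp add: compact_op_rank_one)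

section \<open>Recognising scalar operators\<close>

text \<open>Remove from \<open>z\<close> its component along \<open>y\<close>. The rest is
  orthogonal to \<open>y\<close>, hence to \<open>z\<close> by assumption, hence to itself.\<close>

lemma eigenvectorI:
  fixes z :: "'h::chilbert_space"
  assumes "\<And>x. cinner x y = 0 \<Longrightarrow> cinner x z = 0"
  shows "\<exists>a. z = a *\<^sub>C y"
proof (cases "y = 0")
  case True
  then have "cinner z z = 0" using assms by (simp add: cinner_zero_right)
  then have "z = 0 *\<^sub>C y" by (simp add: cinner_self)
  then show ?thesis by blast
next
  case False
  define a where "a = cinner y z / cinner y y"
  define x where "x = z - a *\<^sub>C y"
  have "cinner y x = 0"
    using False by (simp add: x_def cinner_diff_right cinner_scaleC_right a_def cinner_self)
  then have xy: "cinner x y = 0" by (metis cinner_commute complex_cnj_zero)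
  then have "cinner x x = 0"
    using assms[of x] by (simp add: x_def cinner_diff_right cinner_scaleC_right)
  then show ?thesis by (auto simp: cinner_self x_def)
qed

lemma scalar_if_all_eigenvectors:
  fixes A :: "'h::{chilbert_space,perfect_space} bop"
  assumes "\<And>y. \<exists>a. bop_apply A y = a *\<^sub>C y"
  shows "\<exists>a. A = a *\<^sub>C 1"
proof -
  interpret A: bounded_linear "bop_apply A" by (rule bounded_linear_bop_apply)
  obtain e :: 'h where e: "e \<noteq> 0"
    by (metis UNIV_not_singleton UNIV_eq_I singletonI)
  obtain a where a: "bop_apply A e = a *\<^sub>C e" using assms by blast
  have "bop_apply A y = a *\<^sub>C y" for y
  proof -
    obtain b where b: "bop_apply A y = b *\<^sub>C y" using assms by blast
    obtain d where d: "bop_apply A (e + y) = d *\<^sub>C (e + y)" using assms by blast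
    \<comment> \<open>The eigenvalues at e, y and e + y are compared: either \<open>y\<close> is a
      multiple of \<open>e\<close>, or all three coincide.\<close>
    have eq: "(a - d) *\<^sub>C e = (d - b) *\<^sub>C y"
      using d by (simp add: A.add a b scaleC_add_right scaleC_diff_left algebra_simps)
    show ?thesis
    proof (cases "b = d")
      case True
      then have "cmod (a - d) * norm e = 0" using eq by (metis norm_scaleC norm_zero diff_self scaleC_zero_left)
      then show ?thesis using e b True by simp
    next
      case False
      have "y = ((a - d) / (d - b)) *\<^sub>C e"
        using arg_cong[OF eq, of "\<lambda>v. (1 / (d - b)) *\<^sub>C v"] False by (simp add: scaleC_scaleC)
      then show ?thesis by (metis a bop_apply_scaleC scaleC_scaleC mult.commute)
    qed
  qed
  then have "A = a *\<^sub>C 1" by (intro bop_eqI) (simp add: scaleC_bop_apply)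
  then show ?thesis ..
qed

section \<open>The propagator\<close>

text \<open>As a real multiple of one fixed element in the exponent, t gives the group law and the
  derivative at once.\<close>

definition propagator :: "'h::{chilbert_space,perfect_space} bop \<Rightarrow> real \<Rightarrow> 'h bop" where
  "propagator h t = exp (t *\<^sub>R ((- \<i>) *\<^sub>C h))"

lemma propagator_0: "propagator h 0 = 1"
  by (simp add: propagator_def)

lemma propagator_add: "propagator h (s + t) = propagator h s * propagator h t"
  unfolding propagator_def scaleR_add_left by (rule exp_add_commuting) simp

lemma propagator_minus: "propagator h t * propagator h (- t) = 1"
  "propagator h (- t) * propagator h t = 1"
  using propagator_add[of h t "- t"] propagator_add[of h "- t" t] by (simp_all add: propagator_0)

lemma star_propagator:
  assumes "star h = h" shows "star (propagator h t) = propagator h (- t)"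
proof -
  have "star (t *\<^sub>R ((- \<i>) *\<^sub>C h)) = (- t) *\<^sub>R ((- \<i>) *\<^sub>C h)"
    by (simp add: star_scaleR star_scaleC assms scaleC_scaleC flip: scaleC_of_real)
  then show ?thesis by (simp add: propagator_def star_exp)
qed

lemma continuous_propagator: "continuous (at t within S) (propagator h)"
  unfolding propagator_def
  by (rule has_vector_derivative_continuous[OF exp_scaleR_has_vector_derivative_right])

lemma of_uc_conj_propagator:
  "of_uc (conj_semigroup h t b) = propagator h (- t) * of_uc b * propagator h t"
  by (simp add: of_uc_conj_semigroup propagator_def scaleC_scaleC mult.commute
      flip: scaleC_of_real)

lemma star_endomorphism_conj_semigroup:
  assumes "star h = h" shows "star_endomorphism_semigroup (conj_semigroup h)"
proof
  note [simp] = of_uc_conj_propagator plus_unitized_compacts.rep_eq times_unitized_compacts.rep_eq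
    scaleC_unitized_compacts.rep_eq star_unitized_compacts.rep_eq one_unitized_compacts.rep_eq
  fix s t :: real and a b :: "'a unitized_compacts" and z
  show "conj_semigroup h t (a + b) = conj_semigroup h t a + conj_semigroup h t b"
    "conj_semigroup h t (z *\<^sub>C a) = z *\<^sub>C conj_semigroup h t a"
    "conj_semigroup h t (star a) = star (conj_semigroup h t a)"
    "conj_semigroup h t 1 = 1" "conj_semigroup h 0 a = a"
    by (simp_all flip: of_uc_inject add: distrib_left distrib_right mult_scaleC_left
        mult_scaleC_right star_mult star_propagator assms mult.assoc propagator_0
        propagator_minus)
  have "propagator h (- t) * A * propagator h t * (propagator h (- t) * B * propagator h t) =
      propagator h (- t) * A * (propagator h t * propagator h (- t)) * B * propagator h t" for A B
    by (simp only: mult.assoc)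
  then have "propagator h (- t) * A * propagator h t * (propagator h (- t) * B * propagator h t) =
      propagator h (- t) * (A * B) * propagator h t" for A B
    by (simp add: propagator_minus mult.assoc)
  then show "conj_semigroup h t (a * b) = conj_semigroup h t a * conj_semigroup h t b"
    by (simp flip: of_uc_inject)
  \<comment> \<open>The two outer factors are split in opposite orders, so that conjugation for t
    ends up inside that for s.\<close>
  have "propagator h (- (s + t)) = propagator h (- s) * propagator h (- t)"
    using propagator_add[of h "- s" "- t"] by simp
  moreover have "propagator h (s + t) = propagator h t * propagator h s"
    using propagator_add[of h t s] by (simp add: add.commute)
  ultimately show "conj_semigroup h (s + t) a = conj_semigroup h s (conj_semigroup h t a)"
    unfolding of_uc_inject[symmetric] of_uc_conj_propagator by (simp only: mult.assoc)
qed

section \<open>Uniform continuity\<close>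

lemma bounded_linear_conj_semigroup: "bounded_linear (conj_semigroup h t)"
proof (rule bounded_linear_intro[where K="norm (propagator h (- t)) * norm (propagator h t)"])
  note [simp] = of_uc_conj_propagator plus_unitized_compacts.rep_eq of_uc_scaleR
  fix a b r
  show "conj_semigroup h t (a + b) = conj_semigroup h t a + conj_semigroup h t b"
    "conj_semigroup h t (r *\<^sub>R a) = r *\<^sub>R conj_semigroup h t a"
    by (simp_all flip: of_uc_inject add: distrib_left distrib_right)
  have "norm (propagator h (- t) * of_uc a * propagator h t) \<le>
      norm (propagator h (- t)) * norm (of_uc a) * norm (propagator h t)"
    by (intro order_trans[OF norm_mult_ineq] mult_right_mono norm_mult_ineq) simp
  then show "norm (conj_semigroup h t a) \<le>
      norm a * (norm (propagator h (- t)) * norm (propagator h t))"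
    by (simp add: norm_unitized_compacts.rep_eq mult_ac)
qed

lemma uniformly_cont_conj_semigroup:
  fixes h :: "'a::{chilbert_space,perfect_space} bop"
  shows "uniformly_cont (conj_semigroup h)"
  unfolding uniformly_cont_def
proof (intro conjI allI impI)
  fix t :: real
  show "bounded_linear (conj_semigroup h t)" by (rule bounded_linear_conj_semigroup)
  let ?F = "at t within {0..}" and ?U = "propagator h"
  \<comment> \<open>The bound obtained by changing the two outer factors one at a time. It tends to
    0 because the propagator of the bounded operator h is norm continuous.\<close>
  let ?g = "\<lambda>s. norm (?U (- s) - ?U (- t)) * norm (?U s) + norm (?U (- t)) * norm (?U s - ?U t)"
  have le: "onorm (\<lambda>b. conj_semigroup h s b - conj_semigroup h t b) \<le> ?g s" for s
  proof (rule onorm_bound)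
    fix b :: "'a unitized_compacts"
    let ?b = "of_uc b"
    have "?U (- s) * ?b * ?U s - ?U (- t) * ?b * ?U t =
        (?U (- s) - ?U (- t)) * ?b * ?U s + ?U (- t) * ?b * (?U s - ?U t)"
      by (simp add: algebra_simps)
    also have "norm \<dots> \<le> norm (?U (- s) - ?U (- t)) * norm ?b * norm (?U s) +
        norm (?U (- t)) * norm ?b * norm (?U s - ?U t)"
      by (intro norm_triangle_mono order_trans[OF norm_mult_ineq] mult_right_mono norm_mult_ineq)
        simp_all
    finally show "norm (conj_semigroup h s b - conj_semigroup h t b) \<le> ?g s * norm b"
      by (simp add: norm_unitized_compacts.rep_eq minus_unitized_compacts.rep_eq
          of_uc_conj_propagator algebra_simps)
  qed simp
  have U: "(?U \<longlongrightarrow> ?U t) ?F"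
    using continuous_propagator[of t "{0..}" h] by (simp add: continuous_within)
  have "isCont ?U (- t)" using continuous_propagator[of "- t" UNIV h] by simp
  then have U': "((\<lambda>s. ?U (- s)) \<longlongrightarrow> ?U (- t)) ?F"
    by (rule isCont_tendsto_compose) (intro tendsto_intros)
  have "(?g \<longlongrightarrow> norm (?U (- t) - ?U (- t)) * norm (?U t) + norm (?U (- t)) * norm (?U t - ?U t)) ?F"
    by (intro tendsto_intros U U')
  then have g: "(?g \<longlongrightarrow> 0) ?F" by simp
  show "((\<lambda>s. onorm (\<lambda>b. conj_semigroup h s b - conj_semigroup h t b)) \<longlongrightarrow> 0) ?F"
  proof (rule tendsto_sandwich[OF _ _ tendsto_const g])
    show "\<forall>\<^sub>F s in ?F. 0 \<le> onorm (\<lambda>b. conj_semigroup h s b - conj_semigroup h t b)"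
      by (intro always_eventually allI onorm_pos_le bounded_linear_sub
          bounded_linear_conj_semigroup)
  qed (use le in simp)
qed

text \<open>The GNS formula recovers T only for t \<ge> 0; the filter within \<open>{0..}\<close>
  sees no other parameters.\<close>

lemma uniformly_cont_cong:
  assumes "\<And>t b. t \<ge> 0 \<Longrightarrow> S t b = T t b" and "uniformly_cont T"
  shows "uniformly_cont S"
proof -
  have eq: "S t = T t" if "t \<ge> 0" for t using assms(1) that by blast
  have "((\<lambda>s. onorm (\<lambda>b. S s b - S t b)) \<longlongrightarrow> 0) (at t within {0..})" if "t \<ge> 0" for t
  proof (rule Lim_transform_within[OF _ zero_less_one])
    show "((\<lambda>s. onorm (\<lambda>b. T s b - T t b)) \<longlongrightarrow> 0) (at t within {0..})"
      using assms(2) that by (simp add: uniformly_cont_def)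
  qed (simp add: eq that)
  with assms(2) show ?thesis by (simp add: uniformly_cont_def eq)
qed

section \<open>Semigroups of scalar multiples of the propagator\<close>

lemma scaleC_in_range: "A \<in> range of_uc \<Longrightarrow> z *\<^sub>C A \<in> range of_uc"
  by (metis rangeE rangeI scaleC_unitized_compacts.rep_eq)

text \<open>For small t > 0 the quotients (u_t - 1)/t belong to the algebra. They converge in norm
  to -ih, and the algebra is norm closed.\<close>

lemma generator_in_range:
  fixes h :: "'h::{chilbert_space,perfect_space} bop"
  assumes "t0 > 0" and U: "\<And>t. 0 < t \<Longrightarrow> t < t0 \<Longrightarrow> propagator h t \<in> range of_uc"
  shows "h \<in> range of_uc"
proof -
  let ?A = "(- \<i>) *\<^sub>C h"
  let ?q = "\<lambda>t. (1 / t) *\<^sub>R (propagator h t - 1)"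
  have "(propagator h has_vector_derivative ?A) (at_right 0)"
    unfolding propagator_def[abs_def]
    using exp_scaleR_has_vector_derivative_right[of ?A 0 "{0<..}"] by simp
  then have "((\<lambda>t. (1 / norm t) *\<^sub>R (propagator h t - (1 + t *\<^sub>R ?A))) \<longlongrightarrow> 0) (at_right 0)"
    by (simp add: has_vector_derivative_def has_derivative_within propagator_0)
  moreover have "\<forall>\<^sub>F t in at_right (0::real).
      (1 / norm t) *\<^sub>R (propagator h t - (1 + t *\<^sub>R ?A)) = ?q t - ?A"
    using eventually_at_right_less[of "0::real"]
    by eventually_elim (simp add: scaleR_diff_right scaleR_add_right)
  ultimately have "((\<lambda>t. ?q t - ?A) \<longlongrightarrow> 0) (at_right 0)" by (rule Lim_transform_eventually)
  then have lim: "(?q \<longlongrightarrow> ?A) (at_right 0)" by (simp add: Lim_null[of ?q ?A])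
  have ev: "\<forall>\<^sub>F t in at_right 0. ?q t \<in> range of_uc"
    unfolding eventually_at_right_field
  proof (intro exI conjI allI impI)
    fix t assume "0 < t" "t < t0"
    then obtain u where "propagator h t = of_uc u" using U by blast
    then have "?q t = of_uc ((1 / t) *\<^sub>R (u - 1))"
      by (simp add: of_uc_scaleR minus_unitized_compacts.rep_eq one_unitized_compacts.rep_eq)
    then show "?q t \<in> range of_uc" by simp
  qed (fact \<open>t0 > 0\<close>)
  have "closed (range of_uc :: 'h bop set)"
    using closed_range_of_uc
    by (simp add: type_definition.Rep_range[OF type_definition_unitized_compacts])
  then have "?A \<in> range of_uc" by (rule Lim_in_closed_set[OF _ ev _ lim]) simp
  then have "\<i> *\<^sub>C ?A \<in> range of_uc" by (rule scaleC_in_range)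
  then show ?thesis by (simp add: scaleC_scaleC)
qed

lemma generator_in_range_if_scalar_multiples:
  fixes c :: "real \<Rightarrow> 'h::{chilbert_space,perfect_space} unitized_compacts"
  assumes c_mult: "\<And>s t. s \<ge> 0 \<Longrightarrow> t \<ge> 0 \<Longrightarrow> c s * c t = c (s + t)"
    and scalar: "\<And>t. t \<ge> 0 \<Longrightarrow> \<exists>a. of_uc (c t) * propagator h (- t) = a *\<^sub>C 1"
    and t0: "t0 > 0" "c t0 \<noteq> 0"
  shows "h \<in> range of_uc"
proof (rule generator_in_range[OF t0(1)])
  fix t assume t: "0 < t" "t < t0"
  obtain a where "of_uc (c t) * propagator h (- t) = a *\<^sub>C 1" using scalar[of t] t by auto
  then have "of_uc (c t) * (propagator h (- t) * propagator h t) = a *\<^sub>C propagator h t"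
    by (simp add: mult_scaleC_left flip: mult.assoc)
  then have a: "of_uc (c t) = a *\<^sub>C propagator h t" by (simp add: propagator_minus)
  \<comment> \<open>c_t is a left factor of c_{t0}, so one nonvanishing time settles all earlier
    ones, and u_t can be recovered from c_t.\<close>
  have "c t \<noteq> 0" using c_mult[of t "t0 - t"] t t0(2) by auto
  then have "of_uc (c t) \<noteq> 0" by (metis of_uc_inject zero_unitized_compacts.rep_eq)
  then have "a \<noteq> 0" using a by auto
  then have "propagator h t = (1 / a) *\<^sub>C of_uc (c t)" by (simp add: a scaleC_scaleC)
  then show "propagator h t \<in> range of_uc" by (metis rangeI scaleC_in_range)
qed

text \<open>The assumption says that every vector orthogonal to \<open>y\<close> is orthogonal to
  \<open>W y\<close>, so each \<open>y\<close> is an eigenvector. Both obstructions end here, with W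
  = c_t u_{-t}.\<close>

lemma scalar_if_preserves_kernels:
  fixes W :: "'h::{chilbert_space,perfect_space} bop"
  assumes "\<And>x y. bop_apply (rank_one x) y = 0 \<Longrightarrow> bop_apply (rank_one x) (bop_apply W y) = 0"
  shows "\<exists>a. W = a *\<^sub>C 1"
proof (rule scalar_if_all_eigenvectors, rule eigenvectorI)
  fix x y :: 'h assume "cinner x y = 0"
  then have "bop_apply (rank_one x) (bop_apply W y) = 0"
    by (intro assms) (simp add: rank_one_apply)
  then have "norm (cinner x (bop_apply W y) *\<^sub>C x) = 0" by (simp add: rank_one_apply)
  then show "cinner x (bop_apply W y) = 0"
    by (auto simp: norm_scaleC cinner_zero_left)
qed

text \<open>Complete positivity gives \<open>\<parallel>P c\<^sub>t y\<parallel> \<le> \<parallel>P u\<^sub>t y\<parallel>\<close> for \<open>P\<close> of rank one and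
  \<open>u\<^sub>t = e\<^bsup>-ith\<^esup>\<close>.\<close>

lemma not_spatial_conj_semigroup:
  fixes h :: "'h::{chilbert_space,perfect_space} bop"
  assumes "star h = h" and "h \<notin> range of_uc"
  shows "\<not> spatial (conj_semigroup h)"
proof
  assume "spatial (conj_semigroup h)"
  then obtain c where cont: "continuous_on {0..} c" and c0: "c 0 = 1"
    and c_mult: "\<And>s t. s \<ge> 0 \<Longrightarrow> t \<ge> 0 \<Longrightarrow> c s * c t = c (s + t)"
    and cp: "\<And>t. t \<ge> 0 \<Longrightarrow>
      completely_positive (\<lambda>b. conj_semigroup h t b - star (c t) * b * c t)"
    unfolding spatial_def by blast
  have norm_le: "norm (bop_apply (rank_one x) (bop_apply (of_uc (c t)) y)) \<le>
      norm (bop_apply (rank_one x) (bop_apply (propagator h t) y))" if t: "t \<ge> 0" for t x y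
  proof -
    let ?P = "rank_one x" and ?C = "of_uc (c t)" and ?U = "propagator h t"
    obtain p where p: "of_uc p = ?P" using rank_one_in_range[of x] by (metis rangeE)
    obtain Y where "conj_semigroup h t (star p * p) - star (c t) * (star p * p) * c t = star Y * Y"
    proof -
      \<comment> \<open>Complete positivity for 1 x 1 matrices is positivity at p^*p.\<close>
      have "\<exists>Y :: nat \<Rightarrow> nat \<Rightarrow> _. \<forall>i<Suc 0. \<forall>j<Suc 0.
          conj_semigroup h t (\<Sum>k<Suc 0. star p * p) - star (c t) * (\<Sum>k<Suc 0. star p * p) * c t =
          (\<Sum>k<Suc 0. star (Y k i) * Y k j)"
        using cp[OF t] unfolding completely_positive_def by (elim conjE allE) assumption
      then show ?thesis using that by auto
    qed
    from arg_cong[OF this, of of_uc]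
    have "star ?U * (star ?P * ?P) * ?U = star (of_uc Y) * of_uc Y + star ?C * (star ?P * ?P) * ?C"
      by (simp add: minus_unitized_compacts.rep_eq times_unitized_compacts.rep_eq
          star_unitized_compacts.rep_eq of_uc_conj_propagator p star_propagator assms(1)
          diff_eq_eq)
    then have "cinner y (bop_apply (star ?U * (star ?P * ?P) * ?U) y) =
        cinner y (bop_apply (star (of_uc Y) * of_uc Y) y) +
        cinner y (bop_apply (star ?C * (star ?P * ?P) * ?C) y)"
      by (simp add: plus_bop_apply cinner_add_right)
    \<comment> \<open>In the vector state of \<open>y\<close>, each term of the form A^*A becomes a
      squared norm.\<close>
    then have "(norm (bop_apply ?P (bop_apply ?U y)))\<^sup>2 =
        (norm (bop_apply (of_uc Y) y))\<^sup>2 + (norm (bop_apply ?P (bop_apply ?C y)))\<^sup>2"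
      unfolding times_bop_apply cinner_star_bop' cinner_self
      by (metis of_real_add of_real_eq_iff)
    then have "(norm (bop_apply ?P (bop_apply ?C y)))\<^sup>2 \<le> (norm (bop_apply ?P (bop_apply ?U y)))\<^sup>2"
      by simp
    then show ?thesis by (rule power2_le_imp_le) simp
  qed
  have "\<exists>a. of_uc (c t) * propagator h (- t) = a *\<^sub>C 1" if t: "t \<ge> 0" for t
  proof (rule scalar_if_preserves_kernels)
    fix x y :: 'h
    assume "bop_apply (rank_one x) y = 0"
    \<comment> \<open>\<open>norm_le\<close> is applied to the vector u_{-t} y, for which the right
      side is the norm of P y, here 0.\<close>
    moreover have "bop_apply (propagator h t) (bop_apply (propagator h (- t)) y) = y"
      by (simp flip: times_bop_apply add: propagator_minus)
    ultimately show "bop_apply (rank_one x) (bop_apply (of_uc (c t) * propagator h (- t)) y) = 0"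
      using norm_le[OF t, of x "bop_apply (propagator h (- t)) y"] by (simp add: times_bop_apply)
  qed
  moreover obtain t0 where "t0 > 0" "c t0 \<noteq> 0"
  proof -
    \<comment> \<open>Continuity at 0 together with c_0 = 1 provides a positive time at which c does
      not vanish.\<close>
    have "(c \<longlongrightarrow> 1) (at 0 within {0..})" using cont unfolding continuous_on_def c0[symmetric] by simp
    then have lim: "(c \<longlongrightarrow> 1) (at_right 0)" by (rule tendsto_within_subset) auto
    have "\<forall>\<^sub>F t in at_right 0. c t \<noteq> 0" by (rule tendsto_imp_eventually_ne[OF lim]) simp
    then obtain b where "b > 0" "\<And>y. 0 < y \<Longrightarrow> y < b \<Longrightarrow> c y \<noteq> 0"
      by (auto simp: eventually_at_right_field)
    then show ?thesis by (intro that[of "b / 2"]) auto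
  qed
  ultimately show False
    using generator_in_range_if_scalar_multiples[of c h] c_mult assms(2) by blast
qed

lemma not_embeds_time_ordered_system:
  fixes E :: "('h::{chilbert_space,perfect_space} unitized_compacts, 'e::ab_group_add) psys"
    and F :: "('h unitized_compacts, 'f::ab_group_add) corr"
  assumes "star h = h" and "h \<notin> range of_uc" and "gns_system (conj_semigroup h) E \<xi>"
  shows "\<not> embeds E (time_ordered_system F)"
proof
  interpret star_endomorphism_semigroup "conj_semigroup h"
    by (rule star_endomorphism_conj_semigroup) fact
  assume emb: "embeds E (time_ordered_system F)"
  show False
  proof (rule vacuum_component[OF assms(3) emb])
    fix c t0
    assume c_mult: "\<And>s t. s \<ge> 0 \<Longrightarrow> t \<ge> 0 \<Longrightarrow> c s * c t = c (s + t)"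
      and comm: "\<And>t b. t \<ge> 0 \<Longrightarrow> b * c t = c t * conj_semigroup h t b"
      and t0: "t0 > (0::real)" "c t0 \<noteq> 0"
    have "\<exists>a. of_uc (c t) * propagator h (- t) = a *\<^sub>C 1" if t: "t \<ge> 0" for t
    proof (rule scalar_if_preserves_kernels)
      let ?W = "of_uc (c t) * propagator h (- t)"
      fix x y :: 'h
      obtain p where p: "of_uc p = rank_one x" using rank_one_in_range[of x] by (metis rangeE)
      \<comment> \<open>The commutation relation at b = P. Multiplying by u_{-t} from the right
        shows that W commutes with P and so preserves its kernel.\<close>
      have "rank_one x * of_uc (c t) = ?W * rank_one x * propagator h t"
        using arg_cong[OF comm[OF t, of p], of of_uc]
        by (simp add: times_unitized_compacts.rep_eq of_uc_conj_propagator p mult.assoc)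
      then have "rank_one x * ?W = ?W * rank_one x * (propagator h t * propagator h (- t))"
        by (simp flip: mult.assoc)
      then have "rank_one x * ?W = ?W * rank_one x" by (simp add: propagator_minus)
      then have "bop_apply (rank_one x) (bop_apply ?W y) = bop_apply ?W (bop_apply (rank_one x) y)"
        by (simp flip: times_bop_apply)
      moreover assume "bop_apply (rank_one x) y = 0"
      ultimately show "bop_apply (rank_one x) (bop_apply ?W y) = 0"
        using bop_apply_scaleC[of ?W 0 0] by simp
    qed
    then show False
      using generator_in_range_if_scalar_multiples[of c h, OF c_mult _ t0] assms(2) by blast
  qed
qed

text \<open>The generating unit alone is a continuous set: the only semigroup it defines is
  T.\<close>

lemma type_I_gns_system:
  assumes "gns_system T E \<xi>" and "uniformly_cont T"
  shows "type_I E"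
  unfolding type_I_def
proof (intro exI conjI)
  have "uniformly_cont (\<lambda>t b. ip (fib E t) (\<xi> t) (lact (fib E t) b (\<xi> t)))"
    by (rule uniformly_cont_cong[OF _ assms(2)]) (use assms(1) in \<open>simp add: gns_system_def\<close>)
  then show "continuous_units E {\<xi>}"
    using assms(1) by (simp add: continuous_units_def gns_system_def)
  show "generated_by E {\<xi>}" using assms(1) by (simp add: gns_system_def)
qed

theorem theorem4p8:
  fixes h :: "'h::{chilbert_space,perfect_space} bop"
  assumes "\<nexists>S :: 'h set. finite S \<and> (\<forall>x. \<exists>c. x = (\<Sum>s\<in>S. c s *\<^sub>C s))"
    and "star h = h"
    and "h \<notin> range of_uc"
  shows "markov_semigroup (conj_semigroup h) \<and> uniformly_cont (conj_semigroup h) \<and>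
    \<not> spatial (conj_semigroup h) \<and>
    gns_system (conj_semigroup h) (endo_system (conj_semigroup h)) (\<lambda>t. 1) \<and>
    (\<forall>(E :: ('h unitized_compacts, 'e::ab_group_add) psys) \<xi>.
       gns_system (conj_semigroup h) E \<xi> \<longrightarrow>
       type_I E \<and>
       (\<forall>F :: ('h unitized_compacts, 'f::ab_group_add) corr.
          correspondence F \<longrightarrow> \<not> embeds E (time_ordered_system F)))"
proof (intro conjI allI impI)
  interpret star_endomorphism_semigroup "conj_semigroup h"
    by (rule star_endomorphism_conj_semigroup) fact
  show "markov_semigroup (conj_semigroup h)" by (rule markov)
  show "gns_system (conj_semigroup h) (endo_system (conj_semigroup h)) (\<lambda>t. 1)"
    by (rule gns_endo_system)
  show "\<not> spatial (conj_semigroup h)" by (rule not_spatial_conj_semigroup) fact+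
  show "uniformly_cont (conj_semigroup h)" by (rule uniformly_cont_conj_semigroup)
  fix E :: "('h unitized_compacts, 'e) psys" and \<xi>
  assume gns: "gns_system (conj_semigroup h) E \<xi>"
  show "type_I E" by (rule type_I_gns_system[OF gns uniformly_cont_conj_semigroup])
  show "\<not> embeds E (time_ordered_system F)" for F :: "('h unitized_compacts, 'f) corr"
    by (rule not_embeds_time_ordered_system[OF assms(2,3) gns])
qed

end
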